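(* Let $\Sigma$ be a well-formed LF signature and $\Gamma$ a context such that $\vdash\Gamma\ \mathrm{ctx}$ is derivable. For a term $R$, a type $A'$ and $1\le i\le n+1$, write $\theta_i=\{\langle y_1,M_1,A_1^-\rangle,\ldots,\langle y_{i-1},M_{i-1},A_{i-1}^-\rangle\}$ whenever the terms and types named are given. (1) $\Gamma\vdash R\Rightarrow A'$ has a derivation if (a) $R$ is of the form $c\,M_1\ldots M_n$ for some $c{:}\Pi y_1{:}A_1.\ldots\Pi y_n{:}A_n.A\in\Sigma$ or of the form $x\,M_1\ldots M_n$ for some $x{:}\Pi y_1{:}A_1.\ldots\Pi y_n{:}A_n.A\in\Gamma$; (b) there is a sequence of types $A_1',\ldots,A_n'$ such that for $1\le i\le n$ there are derivations of $[\theta_i]A_i=A_i'$ and $\Gamma\vdash M_i\Leftarrow A_i'$; and (c) $[\theta_{n+1}]A=A'$ and $\Gamma\vdash A'\ \mathrm{type}$ have derivations. (2) $\Gamma\vdash R\Rightarrow A'$ has a derivation of height $h$ only if (a) $R$ is of the form $c\,M_1\ldots M_n$ for some $c{:}\Pi y_1{:}A_1.\ldots\Pi y_n{:}A_n.A\in\Sigma$ or of the form $x\,M_1\ldots M_n$ for some $x{:}\Pi y_1{:}A_1.\ldots\Pi y_n{:}A_n.A\in\Gamma$; (b) there is a sequence of types $A_1',\ldots,A_n'$ such that for $1\le i\le n$ there is a derivation of $[\theta_i]A_i=A_i'$ and a derivation of height less than $h$ of $\Gamma\vdash M_i\Leftarrow A_i'$; and (c) $[\theta_{n+1}]A=A'$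 and $\Gamma\vdash A'\ \mathrm{type}$ have derivations.
   Context: Canonical LF syntax: kinds $K::=\mathrm{Type}\mid\Pi x{:}A.K$; types $A::=P\mid\Pi x{:}A.B$; atomic types $P::=a\mid P\,M$; canonical terms $M::=R\mid\lambda x.M$; atomic terms $R::=c\mid x\mid R\,M$; signatures $\Sigma::=\cdot\mid\Sigma,c{:}A\mid\Sigma,a{:}K$; contexts $\Gamma::=\cdot\mid\Gamma,x{:}A$ (up to renaming of bound variables). Arity types from $o$ and $\rightarrow$; erasure $P^-=o$, $(\Pi x{:}A_1.A_2)^-=A_1^-\rightarrow A_2^-$. A substitution is a finite set of triples $\langle x,M,\alpha\rangle$ (distinct variables, canonical terms, arity types). Hereditary substitution $[\theta]E=E'$ is the least relation closed under: $[\theta]R=R'$ if $[\theta]_rR=R'$; $[\theta]R=M'$ if $[\theta]_rR=M':\alpha'$; $[\theta](\lambda x.M)=\lambda x.M'$ if $x$ is not in $\mathrm{dom}(\theta)$ nor free in its range terms and $[\theta]M=M'$; $[\theta]_rx=M:\alpha$ if $\langle x,M,\alpha\rangle\in\theta$; $[\theta]_r(R\,M)=M''':\alpha''$ if $[\theta]_rR=\lambda x.M':\alpha'\rightarrow\alpha''$, $[\theta]M=M''$, $[\{\langle x,M'',\alpha'\rangle\}]M'=M'''$; $[\theta]_rc=c$; $[\theta]_rx=x$ if $x\notin\mathrm{dom}(\theta)$; $[\theta]_r(R\,M)=R'\,M'$ if $[\theta]_rR=R'$ and $[\theta]M=M'$; for types $[\theta]a=a$, $[\theta](P\,M)=P'\,M'$,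 $[\theta](\Pi x{:}A_1.A_2)=\Pi x{:}A_1'.A_2'$ componentwise (binder fresh for $\theta$); kinds analogously with $[\theta]\mathrm{Type}=\mathrm{Type}$. LF judgements (fixed $\Sigma$; rules with binders assume the bound variable is not in $\Gamma$): $\vdash\cdot\ \mathrm{ctx}$; $\vdash\Gamma,x{:}A\ \mathrm{ctx}$ if $\vdash\Gamma\ \mathrm{ctx}$, $\Gamma\vdash A\ \mathrm{type}$, $x$ not in $\Gamma$; $\Gamma\vdash\mathrm{Type}\ \mathrm{kind}$; $\Gamma\vdash\Pi x{:}A.K\ \mathrm{kind}$ if $\Gamma\vdash A\ \mathrm{type}$ and $\Gamma,x{:}A\vdash K\ \mathrm{kind}$; $\Gamma\vdash P\ \mathrm{type}$ if $\Gamma\vdash P\Rightarrow\mathrm{Type}$; $\Gamma\vdash\Pi x{:}A_1.A_2\ \mathrm{type}$ if $\Gamma\vdash A_1\ \mathrm{type}$ and $\Gamma,x{:}A_1\vdash A_2\ \mathrm{type}$; $\Gamma\vdash a\Rightarrow K$ if $a{:}K\in\Sigma$; $\Gamma\vdash P\,M\Rightarrow K$ if $\Gamma\vdash P\Rightarrow\Pi x{:}A.K_1$, $\Gamma\vdash M\Leftarrow A$ and $[\{\langle x,M,A^-\rangle\}]K_1=K$; $\Gamma\vdash R\Leftarrow P$ if $\Gamma\vdash R\Rightarrow P$; $\Gamma\vdash\lambda x.M\Leftarrow\Pi x{:}A_1.A_2$ if $\Gamma,x{:}A_1\vdash M\Leftarrow A_2$; $\Gamma\vdash x\Rightarrow A$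 if $x{:}A\in\Gamma$; $\Gamma\vdash c\Rightarrow A$ if $c{:}A\in\Sigma$; $\Gamma\vdash R\,M\Rightarrow A$ if $\Gamma\vdash R\Rightarrow\Pi x{:}A_1.A_2$, $\Gamma\vdash M\Leftarrow A_1$ and $[\{\langle x,M,A_1^-\rangle\}]A_2=A$. The height of a derivation is as usual (a single rule application has height 1). $\Sigma$ is well-formed if its constants are distinct and each $c{:}A$ (resp. $a{:}K$) satisfies $\cdot\vdash A\ \mathrm{type}$ (resp. $\cdot\vdash K\ \mathrm{kind}$) relative to the preceding declarations. *)

theory Defs
  imports Main
begin

type_synonym var = string
type_synonym oconst = string
type_synonym tconst = string

text \<open>
  Expressions up to renaming of bound variables are represented in locally nameless style: free
  variables are names, bound variables are de Bruijn indices. The raw constructors for binders are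
  hidden behind the named abstractions \<open>lam\<close>, \<open>pi\<close> and \<open>kpi\<close> below, which are the only binders
  used in the definitions of substitution and of the judgements. A dangling index is not an
  expression of the calculus; no rule of substitution or typing applies to one.
\<close>

datatype tm = Atm atm | LamB tm
  and atm = Const oconst | FVar var | BVar nat | App atm tm

datatype aty = TConst tconst | TApp aty tm

datatype ty = Base aty | PiB ty ty

datatype kd = Type | KPiB ty kd

datatype arity = Obj | Arr arity arity

fun erase :: "ty \<Rightarrow> arity" where
  "erase (Base P) = Obj"
| "erase (PiB A B) = Arr (erase A) (erase B)"

text \<open>
  \<open>abs_tm k x M\<close> replaces the free variable \<open>x\<close> by the index \<open>k\<close>. Indices from \<open>k\<close> on are
  shifted, so that abstraction never captures an index.
\<close>

primrec abs_tm :: "nat \<Rightarrow> var \<Rightarrow> tm \<Rightarrow> tm"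
  and abs_atm :: "nat \<Rightarrow> var \<Rightarrow> atm \<Rightarrow> atm" where
  "abs_tm k x (Atm R) = Atm (abs_atm k x R)"
| "abs_tm k x (LamB M) = LamB (abs_tm (Suc k) x M)"
| "abs_atm k x (Const c) = Const c"
| "abs_atm k x (FVar y) = (if y = x then BVar k else FVar y)"
| "abs_atm k x (BVar i) = BVar (if i < k then i else Suc i)"
| "abs_atm k x (App R M) = App (abs_atm k x R) (abs_tm k x M)"

primrec abs_aty :: "nat \<Rightarrow> var \<Rightarrow> aty \<Rightarrow> aty" where
  "abs_aty k x (TConst a) = TConst a"
| "abs_aty k x (TApp P M) = TApp (abs_aty k x P) (abs_tm k x M)"

primrec abs_ty :: "nat \<Rightarrow> var \<Rightarrow> ty \<Rightarrow> ty" where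
  "abs_ty k x (Base P) = Base (abs_aty k x P)"
| "abs_ty k x (PiB A B) = PiB (abs_ty k x A) (abs_ty (Suc k) x B)"

primrec abs_kd :: "nat \<Rightarrow> var \<Rightarrow> kd \<Rightarrow> kd" where
  "abs_kd k x Type = Type"
| "abs_kd k x (KPiB A K) = KPiB (abs_ty k x A) (abs_kd (Suc k) x K)"

definition lam :: "var \<Rightarrow> tm \<Rightarrow> tm" where
  "lam x M = LamB (abs_tm 0 x M)"

definition pi :: "var \<Rightarrow> ty \<Rightarrow> ty \<Rightarrow> ty" where
  "pi x A B = PiB A (abs_ty 0 x B)"

definition kpi :: "var \<Rightarrow> ty \<Rightarrow> kd \<Rightarrow> kd" where
  "kpi x A K = KPiB A (abs_kd 0 x K)"

primrec fv_tm :: "tm \<Rightarrow> var set" and fv_atm :: "atm \<Rightarrow> var set" where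
  "fv_tm (Atm R) = fv_atm R"
| "fv_tm (LamB M) = fv_tm M"
| "fv_atm (Const c) = {}"
| "fv_atm (FVar x) = {x}"
| "fv_atm (BVar i) = {}"
| "fv_atm (App R M) = fv_atm R \<union> fv_tm M"

text \<open>
  The type \<open>subst\<close> does not enforce that a substitution is finite and has distinct variables.
  This holds for the singletons used in the rules below, and for \<open>arg_subst\<close> if the bound
  variables are distinct.
\<close>

type_synonym subst = "(var \<times> tm \<times> arity) set"

definition sdom :: "subst \<Rightarrow> var set" where
  "sdom \<theta> = {x. \<exists>M \<alpha>. (x, M, \<alpha>) \<in> \<theta>}"

definition fresh_for :: "var \<Rightarrow> subst \<Rightarrow> bool" where
  "fresh_for x \<theta> \<longleftrightarrow> x \<notin> sdom \<theta> \<and> (\<forall>(y, M, \<alpha>) \<in> \<theta>. x \<notin> fv_tm M)"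

text \<open>
  In the inductive predicates with suffix \<open>_h\<close>, the number \<open>h\<close> is the height of the derivation.
  Hereditary substitution: \<open>hsub_tm_h\<close> is \<open>[\<theta>]M = M'\<close>, \<open>hsub_atm_h\<close> is
  \<open>[\<theta>]\<^sub>r R = R'\<close> and \<open>hsub_red_h\<close> is \<open>[\<theta>]\<^sub>r R = M : \<alpha>\<close>.
\<close>

inductive hsub_tm_h :: "nat \<Rightarrow> subst \<Rightarrow> tm \<Rightarrow> tm \<Rightarrow> bool"
  and hsub_atm_h :: "nat \<Rightarrow> subst \<Rightarrow> atm \<Rightarrow> atm \<Rightarrow> bool"
  and hsub_red_h :: "nat \<Rightarrow> subst \<Rightarrow> atm \<Rightarrow> tm \<Rightarrow> arity \<Rightarrow> bool" where
  tm_atm: "hsub_atm_h h \<theta> R R' \<Longrightarrow> hsub_tm_h (Suc h) \<theta> (Atm R) (Atm R')"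
| tm_red: "hsub_red_h h \<theta> R M' \<alpha>' \<Longrightarrow> hsub_tm_h (Suc h) \<theta> (Atm R) M'"
| tm_lam: "\<lbrakk>fresh_for x \<theta>; hsub_tm_h h \<theta> M M'\<rbrakk>
    \<Longrightarrow> hsub_tm_h (Suc h) \<theta> (lam x M) (lam x M')"
| red_var: "(x, M, \<alpha>) \<in> \<theta> \<Longrightarrow> hsub_red_h 1 \<theta> (FVar x) M \<alpha>"
| red_app: "\<lbrakk>hsub_red_h h1 \<theta> R (lam x M') (Arr \<alpha>' \<alpha>''); hsub_tm_h h2 \<theta> M M'';
      hsub_tm_h h3 {(x, M'', \<alpha>')} M' M'''\<rbrakk>
    \<Longrightarrow> hsub_red_h (Suc (max h1 (max h2 h3))) \<theta> (App R M) M''' \<alpha>''"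
| atm_const: "hsub_atm_h 1 \<theta> (Const c) (Const c)"
| atm_var: "x \<notin> sdom \<theta> \<Longrightarrow> hsub_atm_h 1 \<theta> (FVar x) (FVar x)"
| atm_app: "\<lbrakk>hsub_atm_h h1 \<theta> R R'; hsub_tm_h h2 \<theta> M M'\<rbrakk>
    \<Longrightarrow> hsub_atm_h (Suc (max h1 h2)) \<theta> (App R M) (App R' M')"

inductive hsub_aty_h :: "nat \<Rightarrow> subst \<Rightarrow> aty \<Rightarrow> aty \<Rightarrow> bool" where
  aty_const: "hsub_aty_h 1 \<theta> (TConst a) (TConst a)"
| aty_app: "\<lbrakk>hsub_aty_h h1 \<theta> P P'; hsub_tm_h h2 \<theta> M M'\<rbrakk>
    \<Longrightarrow> hsub_aty_h (Suc (max h1 h2)) \<theta> (TApp P M) (TApp P' M')"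

text \<open>
  \<open>Base\<close> only embeds atomic types into types, so \<open>ty_base\<close> is not a rule of its own and does not
  add to the height.
\<close>

inductive hsub_ty_h :: "nat \<Rightarrow> subst \<Rightarrow> ty \<Rightarrow> ty \<Rightarrow> bool" where
  ty_base: "hsub_aty_h h \<theta> P P' \<Longrightarrow> hsub_ty_h h \<theta> (Base P) (Base P')"
| ty_pi: "\<lbrakk>fresh_for x \<theta>; hsub_ty_h h1 \<theta> A1 A1'; hsub_ty_h h2 \<theta> A2 A2'\<rbrakk>
    \<Longrightarrow> hsub_ty_h (Suc (max h1 h2)) \<theta> (pi x A1 A2) (pi x A1' A2')"

inductive hsub_kd_h :: "nat \<Rightarrow> subst \<Rightarrow> kd \<Rightarrow> kd \<Rightarrow> bool" where
  kd_type: "hsub_kd_h 1 \<theta> Type Type"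
| kd_pi: "\<lbrakk>fresh_for x \<theta>; hsub_ty_h h1 \<theta> A A'; hsub_kd_h h2 \<theta> K K'\<rbrakk>
    \<Longrightarrow> hsub_kd_h (Suc (max h1 h2)) \<theta> (kpi x A K) (kpi x A' K')"

definition hsub_ty :: "subst \<Rightarrow> ty \<Rightarrow> ty \<Rightarrow> bool" where
  "hsub_ty \<theta> A A' \<longleftrightarrow> (\<exists>h. hsub_ty_h h \<theta> A A')"

datatype decl = ODecl oconst ty | TDecl tconst kd

text \<open>Signatures and contexts grow at the head of the list.\<close>

type_synonym sig = "decl list"
type_synonym ctx = "(var \<times> ty) list"

text \<open>
  \<open>kind_h\<close> is \<open>\<Gamma> \<turnstile> K kind\<close>, \<open>type_h\<close> is \<open>\<Gamma> \<turnstile> A type\<close>, \<open>synth_aty_h\<close> is \<open>\<Gamma> \<turnstile> P \<Rightarrow> K\<close>,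
  \<open>synth_h\<close> is \<open>\<Gamma> \<turnstile> R \<Rightarrow> A\<close> and \<open>check_h\<close> is \<open>\<Gamma> \<turnstile> M \<Leftarrow> A\<close>. The height of a derivation takes
  into account the derivations of its substitution premises.
\<close>

inductive kind_h :: "sig \<Rightarrow> nat \<Rightarrow> ctx \<Rightarrow> kd \<Rightarrow> bool"
  and type_h :: "sig \<Rightarrow> nat \<Rightarrow> ctx \<Rightarrow> ty \<Rightarrow> bool"
  and synth_aty_h :: "sig \<Rightarrow> nat \<Rightarrow> ctx \<Rightarrow> aty \<Rightarrow> kd \<Rightarrow> bool"
  and synth_h :: "sig \<Rightarrow> nat \<Rightarrow> ctx \<Rightarrow> atm \<Rightarrow> ty \<Rightarrow> bool"
  and check_h :: "sig \<Rightarrow> nat \<Rightarrow> ctx \<Rightarrow> tm \<Rightarrow> ty \<Rightarrow> bool"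
  for \<Sigma> :: sig where
  kind_type: "kind_h \<Sigma> 1 \<Gamma> Type"
| kind_pi: "\<lbrakk>x \<notin> fst ` set \<Gamma>; type_h \<Sigma> h1 \<Gamma> A; kind_h \<Sigma> h2 ((x, A) # \<Gamma>) K\<rbrakk>
    \<Longrightarrow> kind_h \<Sigma> (Suc (max h1 h2)) \<Gamma> (kpi x A K)"
| type_base: "synth_aty_h \<Sigma> h \<Gamma> P Type \<Longrightarrow> type_h \<Sigma> (Suc h) \<Gamma> (Base P)"
| type_pi: "\<lbrakk>x \<notin> fst ` set \<Gamma>; type_h \<Sigma> h1 \<Gamma> A1; type_h \<Sigma> h2 ((x, A1) # \<Gamma>) A2\<rbrakk>
    \<Longrightarrow> type_h \<Sigma> (Suc (max h1 h2)) \<Gamma> (pi x A1 A2)"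
| synth_tconst: "TDecl a K \<in> set \<Sigma> \<Longrightarrow> synth_aty_h \<Sigma> 1 \<Gamma> (TConst a) K"
| synth_tapp: "\<lbrakk>synth_aty_h \<Sigma> h1 \<Gamma> P (kpi x A K1); check_h \<Sigma> h2 \<Gamma> M A;
      hsub_kd_h h3 {(x, M, erase A)} K1 K\<rbrakk>
    \<Longrightarrow> synth_aty_h \<Sigma> (Suc (max h1 (max h2 h3))) \<Gamma> (TApp P M) K"
| check_atm: "synth_h \<Sigma> h \<Gamma> R (Base P) \<Longrightarrow> check_h \<Sigma> (Suc h) \<Gamma> (Atm R) (Base P)"
| check_lam: "\<lbrakk>x \<notin> fst ` set \<Gamma>; check_h \<Sigma> h ((x, A1) # \<Gamma>) M A2\<rbrakk>
    \<Longrightarrow> check_h \<Sigma> (Suc h) \<Gamma> (lam x M) (pi x A1 A2)"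
| synth_var: "(x, A) \<in> set \<Gamma> \<Longrightarrow> synth_h \<Sigma> 1 \<Gamma> (FVar x) A"
| synth_const: "ODecl c A \<in> set \<Sigma> \<Longrightarrow> synth_h \<Sigma> 1 \<Gamma> (Const c) A"
| synth_app: "\<lbrakk>synth_h \<Sigma> h1 \<Gamma> R (pi x A1 A2); check_h \<Sigma> h2 \<Gamma> M A1;
      hsub_ty_h h3 {(x, M, erase A1)} A2 A\<rbrakk>
    \<Longrightarrow> synth_h \<Sigma> (Suc (max h1 (max h2 h3))) \<Gamma> (App R M) A"

definition is_kind :: "sig \<Rightarrow> ctx \<Rightarrow> kd \<Rightarrow> bool" where
  "is_kind \<Sigma> \<Gamma> K \<longleftrightarrow> (\<exists>h. kind_h \<Sigma> h \<Gamma> K)"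

definition is_type :: "sig \<Rightarrow> ctx \<Rightarrow> ty \<Rightarrow> bool" where
  "is_type \<Sigma> \<Gamma> A \<longleftrightarrow> (\<exists>h. type_h \<Sigma> h \<Gamma> A)"

definition synth :: "sig \<Rightarrow> ctx \<Rightarrow> atm \<Rightarrow> ty \<Rightarrow> bool" where
  "synth \<Sigma> \<Gamma> R A \<longleftrightarrow> (\<exists>h. synth_h \<Sigma> h \<Gamma> R A)"

definition check :: "sig \<Rightarrow> ctx \<Rightarrow> tm \<Rightarrow> ty \<Rightarrow> bool" where
  "check \<Sigma> \<Gamma> M A \<longleftrightarrow> (\<exists>h. check_h \<Sigma> h \<Gamma> M A)"

inductive is_ctx :: "sig \<Rightarrow> ctx \<Rightarrow> bool" for \<Sigma> :: sig where
  ctx_empty: "is_ctx \<Sigma> []"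
| ctx_ext: "\<lbrakk>is_ctx \<Sigma> \<Gamma>; is_type \<Sigma> \<Gamma> A; x \<notin> fst ` set \<Gamma>\<rbrakk> \<Longrightarrow> is_ctx \<Sigma> ((x, A) # \<Gamma>)"

inductive wf_sig :: "sig \<Rightarrow> bool" where
  sig_empty: "wf_sig []"
| sig_obj: "\<lbrakk>wf_sig \<Sigma>; \<forall>B. ODecl c B \<notin> set \<Sigma>; is_type \<Sigma> [] A\<rbrakk> \<Longrightarrow> wf_sig (ODecl c A # \<Sigma>)"
| sig_ty: "\<lbrakk>wf_sig \<Sigma>; \<forall>L. TDecl a L \<notin> set \<Sigma>; is_kind \<Sigma> [] K\<rbrakk> \<Longrightarrow> wf_sig (TDecl a K # \<Sigma>)"

definition apps :: "atm \<Rightarrow> tm list \<Rightarrow> atm" where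
  "apps R Ms = foldl App R Ms"

fun pis :: "(var \<times> ty) list \<Rightarrow> ty \<Rightarrow> ty" where
  "pis [] A = A"
| "pis ((y, B) # bs) A = pi y B (pis bs A)"

text \<open>
  \<open>spine_form \<Sigma> \<Gamma> R bs A Ms\<close>: the term \<open>R\<close> is \<open>H M\<^sub>1 \<dots> M\<^sub>n\<close> for a constant or variable \<open>H\<close> declared
  with type \<open>\<Pi>y\<^sub>1:A\<^sub>1. \<dots> \<Pi>y\<^sub>n:A\<^sub>n. A\<close>, where \<open>bs\<close> is the list of the pairs \<open>(y\<^sub>i, A\<^sub>i)\<close>. The
  variables \<open>y\<^sub>i\<close> are distinct because they form the domain of a substitution.
\<close>

definition spine_form :: "sig \<Rightarrow> ctx \<Rightarrow> atm \<Rightarrow> (var \<times> ty) list \<Rightarrow> ty \<Rightarrow> tm list \<Rightarrow> bool" where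
  "spine_form \<Sigma> \<Gamma> R bs A Ms \<longleftrightarrow>
     distinct (map fst bs) \<and> length Ms = length bs \<and>
     ((\<exists>c. ODecl c (pis bs A) \<in> set \<Sigma> \<and> R = apps (Const c) Ms) \<or>
      (\<exists>x. (x, pis bs A) \<in> set \<Gamma> \<and> R = apps (FVar x) Ms))"

text \<open>
  Lists are indexed from 0: \<open>arg_subst bs Ms i\<close> has the \<open>i\<close> triples of
  \<open>\<theta>\<^bsub>i+1\<^esub> = {\<langle>y\<^sub>1, M\<^sub>1, A\<^sub>1\<^sup>-\<rangle>, \<dots>, \<langle>y\<^sub>i, M\<^sub>i, A\<^sub>i\<^sup>-\<rangle>}\<close>.
\<close>

definition arg_subst :: "(var \<times> ty) list \<Rightarrow> tm list \<Rightarrow> nat \<Rightarrow> subst" where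
  "arg_subst bs Ms i = {(fst (bs ! j), Ms ! j, erase (snd (bs ! j))) | j. j < i}"

end

theory Submission
  imports Defs
begin

text \<open>
  Erase the canonical expressions to untyped lambda terms. A derivation of \<open>[\<theta>]E = E'\<close> shows that
  the ordinary substitution instance of \<open>E\<close> reduces to the normal form \<open>E'\<close>. By confluence, any two
  ways of carrying out the same substitutions, in particular the simultaneous \<open>\<theta>\<^sub>i\<close> of the statement
  and the one-variable substitutions of the application rule, can only differ in whether they are
  defined. Well-typed expressions are arity-typed, and on these hereditary substitution is total.
  So the two presentations of an argument spine agree. That the synthesized type is well-formed
  follows from the substitution theorem of LF, by induction on the arity of the substituted terms.
\<close>

section \<open>Untyped lambda terms\<close>

text \<open>The application rule substitutes one argument at a time, under whatever bound name the
  derivation uses, while the statement substitutes all arguments at once. Comparing the two directly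
  would take commutation laws for hereditary substitution, with existence of every intermediate
  result. Here no hereditary substitution is ever rebuilt from a reduction. The recurring pattern
  is: totality supplies some result, soundness shows that it and the wanted result are normal forms
  of one lambda term, so they are equal. Bound names disappear in this comparison, since both sides
  are instances of the same de Bruijn body. The second half of the statement needs more care than
  the first: its substitution derivations must be produced, so the names y_i are chosen outside
  \<Gamma> and arity typing is carried along the spine.\<close>

datatype vr = Nm var | Ix nat

text \<open>Types and kinds are encoded as lambda terms too, a product being \<open>CPi\<close> or
  \<open>CKPi\<close> applied to the domain and an abstraction. One substitution function and one
  confluence theorem then serve all five sorts of expressions.\<close>

datatype cst = CObj oconst | CTy tconst | CPi | CKPi | CType

datatype lt = Cst cst | Vr vr | Ap lt lt | Ab lt

fun shift :: "vr \<Rightarrow> vr" where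
  "shift (Nm x) = Nm x"
| "shift (Ix i) = Ix (Suc i)"

fun vcons :: "'a \<Rightarrow> (vr \<Rightarrow> 'a) \<Rightarrow> vr \<Rightarrow> 'a" where
  "vcons a f (Nm x) = f (Nm x)"
| "vcons a f (Ix 0) = a"
| "vcons a f (Ix (Suc i)) = f (Ix i)"

definition upr :: "(vr \<Rightarrow> vr) \<Rightarrow> vr \<Rightarrow> vr" where
  "upr \<xi> = vcons (Ix 0) (shift \<circ> \<xi>)"

primrec ren :: "(vr \<Rightarrow> vr) \<Rightarrow> lt \<Rightarrow> lt" where
  "ren \<xi> (Cst c) = Cst c"
| "ren \<xi> (Vr v) = Vr (\<xi> v)"
| "ren \<xi> (Ap t u) = Ap (ren \<xi> t) (ren \<xi> u)"
| "ren \<xi> (Ab t) = Ab (ren (upr \<xi>) t)"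

definition up :: "(vr \<Rightarrow> lt) \<Rightarrow> vr \<Rightarrow> lt" where
  "up \<sigma> = vcons (Vr (Ix 0)) (ren shift \<circ> \<sigma>)"

primrec sub :: "(vr \<Rightarrow> lt) \<Rightarrow> lt \<Rightarrow> lt" where
  "sub \<sigma> (Cst c) = Cst c"
| "sub \<sigma> (Vr v) = \<sigma> v"
| "sub \<sigma> (Ap t u) = Ap (sub \<sigma> t) (sub \<sigma> u)"
| "sub \<sigma> (Ab t) = Ab (sub (up \<sigma>) t)"

definition inst :: "lt \<Rightarrow> lt \<Rightarrow> lt" where
  "inst t u = sub (vcons u Vr) t"

text \<open>\<open>Ix 0\<close> is not a value of \<open>shift\<close>, so the preimage under
  \<open>shift\<close> both drops the bound index and lowers the others.\<close>

primrec fv :: "lt \<Rightarrow> vr set" where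
  "fv (Cst c) = {}"
| "fv (Vr v) = {v}"
| "fv (Ap t u) = fv t \<union> fv u"
| "fv (Ab t) = {v. shift v \<in> fv t}"

lemma vr_cases: "(\<And>x. v = Nm x \<Longrightarrow> P) \<Longrightarrow> (v = Ix 0 \<Longrightarrow> P) \<Longrightarrow> (\<And>i. v = Ix (Suc i) \<Longrightarrow> P) \<Longrightarrow> P"
  by (metis not0_implies_Suc vr.exhaust)

lemma vr_cases_shift: "(v = Ix 0 \<Longrightarrow> P) \<Longrightarrow> (\<And>w. v = shift w \<Longrightarrow> P) \<Longrightarrow> P"
  by (metis shift.simps vr_cases)

lemma vcons_shift [simp]: "vcons a f (shift v) = f v"
  by (cases v) auto

lemma upr_simps [simp]:
  "upr \<xi> (Ix 0) = Ix 0" "upr \<xi> (Ix (Suc i)) = shift (\<xi> (Ix i))" "upr \<xi> (Nm x) = shift (\<xi> (Nm x))"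
  "upr \<xi> (shift v) = shift (\<xi> v)"
  by (auto simp: upr_def)

lemma up_simps [simp]:
  "up \<sigma> (Ix 0) = Vr (Ix 0)" "up \<sigma> (Ix (Suc i)) = ren shift (\<sigma> (Ix i))"
  "up \<sigma> (Nm x) = ren shift (\<sigma> (Nm x))" "up \<sigma> (shift v) = ren shift (\<sigma> v)"
  by (auto simp: up_def)

text \<open>The composition laws come with renaming before substitution: under a binder,
  \<open>sub_sub\<close> has to move a substitution past the shift inside \<open>up\<close>, which
  is itself a renaming.\<close>

lemma upr_comp: "upr \<xi> \<circ> upr \<zeta> = upr (\<xi> \<circ> \<zeta>)"
  by (rule ext, rule_tac v = x in vr_cases) auto

lemma ren_ren: "ren \<xi> (ren \<zeta> t) = ren (\<xi> \<circ> \<zeta>) t"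
  by (induction t arbitrary: \<xi> \<zeta>) (auto simp: upr_comp)

lemma up_ren_comp: "up \<sigma> \<circ> upr \<zeta> = up (\<sigma> \<circ> \<zeta>)"
  by (rule ext, rule_tac v = x in vr_cases) auto

lemma sub_ren: "sub \<sigma> (ren \<zeta> t) = sub (\<sigma> \<circ> \<zeta>) t"
  by (induction t arbitrary: \<sigma> \<zeta>) (auto simp: up_ren_comp)

lemma ren_shift_upr: "ren (upr \<xi>) (ren shift t) = ren shift (ren \<xi> t)"
proof -
  have "upr \<xi> \<circ> shift = shift \<circ> \<xi>" by auto
  then show ?thesis by (simp add: ren_ren)
qed

lemma ren_up_comp: "ren (upr \<xi>) \<circ> up \<sigma> = up (ren \<xi> \<circ> \<sigma>)"
  by (rule ext, rule_tac v = x in vr_cases) (auto simp: ren_shift_upr)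

lemma ren_sub: "ren \<xi> (sub \<sigma> t) = sub (ren \<xi> \<circ> \<sigma>) t"
  by (induction t arbitrary: \<xi> \<sigma>) (auto simp: ren_up_comp)

lemma sub_up_shift: "sub (up \<sigma>) (ren shift t) = ren shift (sub \<sigma> t)"
proof -
  have "up \<sigma> \<circ> shift = ren shift \<circ> \<sigma>" by auto
  then show ?thesis by (simp add: sub_ren ren_sub)
qed

lemma sub_up_comp: "sub (up \<sigma>) \<circ> up \<tau> = up (sub \<sigma> \<circ> \<tau>)"
  by (rule ext, rule_tac v = x in vr_cases) (auto simp: sub_up_shift)

lemma sub_sub: "sub \<sigma> (sub \<tau> t) = sub (sub \<sigma> \<circ> \<tau>) t"
  by (induction t arbitrary: \<sigma> \<tau>) (auto simp: sub_up_comp)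

lemma up_Vr [simp]: "up Vr = Vr"
  by (rule ext, rule_tac v = x in vr_cases) auto

lemma sub_Vr [simp]: "sub Vr t = t"
  by (induction t) auto

lemma inst_shift [simp]: "sub (vcons u Vr) (ren shift t) = t"
proof -
  have "vcons u Vr \<circ> shift = Vr" by auto
  then show ?thesis by (simp add: sub_ren)
qed

lemma sub_inst: "sub \<sigma> (inst t u) = inst (sub (up \<sigma>) t) (sub \<sigma> u)"
proof -
  have "sub \<sigma> \<circ> vcons u Vr = sub (vcons (sub \<sigma> u) Vr) \<circ> up \<sigma>"
    by (rule ext, rule_tac v = x in vr_cases) auto
  then show ?thesis by (simp add: inst_def sub_sub)
qed

lemma ren_inst: "ren \<xi> (inst t u) = inst (ren (upr \<xi>) t) (ren \<xi> u)"
proof -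
  have "ren \<xi> \<circ> vcons u Vr = vcons (ren \<xi> u) Vr \<circ> upr \<xi>"
    by (rule ext, rule_tac v = x in vr_cases) auto
  then show ?thesis by (simp add: inst_def ren_sub sub_ren)
qed

lemma sub_cong_fv: "(\<And>v. v \<in> fv t \<Longrightarrow> \<sigma> v = \<tau> v) \<Longrightarrow> sub \<sigma> t = sub \<tau> t"
proof (induction t arbitrary: \<sigma> \<tau>)
  case (Ab t)
  have "up \<sigma> v = up \<tau> v" if "v \<in> fv t" for v
    using that Ab.prems by (cases v rule: vr_cases_shift) auto
  then show ?case using Ab.IH[of "up \<sigma>" "up \<tau>"] by simp
next
  case (Ap t u)
  have "sub \<sigma> t = sub \<tau> t" by (rule Ap.IH(1)) (rule Ap.prems, simp)
  moreover have "sub \<sigma> u = sub \<tau> u" by (rule Ap.IH(2)) (rule Ap.prems, simp)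
  ultimately show ?case by simp
qed simp_all

lemma sub_id_fv: "(\<And>v. v \<in> fv t \<Longrightarrow> \<sigma> v = Vr v) \<Longrightarrow> sub \<sigma> t = t"
  using sub_cong_fv[of t \<sigma> Vr] by simp

lemma ren_cong_fv: "(\<And>v. v \<in> fv t \<Longrightarrow> \<xi> v = \<zeta> v) \<Longrightarrow> ren \<xi> t = ren \<zeta> t"
proof (induction t arbitrary: \<xi> \<zeta>)
  case (Ab t)
  have "upr \<xi> v = upr \<zeta> v" if "v \<in> fv t" for v
    using that Ab.prems by (cases v rule: vr_cases_shift) auto
  then show ?case using Ab.IH[of "upr \<xi>" "upr \<zeta>"] by simp
next
  case (Ap t u)
  have "ren \<xi> t = ren \<zeta> t" by (rule Ap.IH(1)) (rule Ap.prems, simp)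
  moreover have "ren \<xi> u = ren \<zeta> u" by (rule Ap.IH(2)) (rule Ap.prems, simp)
  ultimately show ?case by simp
qed simp_all

lemma finite_fv: "finite (fv t)"
proof (induction t)
  case (Ab t)
  have "inj shift" by (rule injI, rename_tac v w, case_tac v; case_tac w) auto
  then show ?case using finite_vimageI[OF Ab] by (simp add: vimage_def)
qed auto

section \<open>Confluence\<close>

inductive par :: "lt \<Rightarrow> lt \<Rightarrow> bool" where
  par_Cst: "par (Cst c) (Cst c)"
| par_Vr: "par (Vr v) (Vr v)"
| par_Ap: "par t t' \<Longrightarrow> par u u' \<Longrightarrow> par (Ap t u) (Ap t' u')"
| par_Ab: "par t t' \<Longrightarrow> par (Ab t) (Ab t')"
| par_beta: "par t t' \<Longrightarrow> par u u' \<Longrightarrow> par (Ap (Ab t) u) (inst t' u')"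

inductive_cases par_CstE: "par (Cst c) t"
inductive_cases par_VrE: "par (Vr v) t"
inductive_cases par_ApE: "par (Ap t u) s"
inductive_cases par_AbE: "par (Ab t) s"

lemma par_refl [simp]: "par t t"
  by (induction t) (auto intro: par.intros)

lemma par_ren: "par t t' \<Longrightarrow> par (ren \<xi> t) (ren \<xi> t')"
  by (induction arbitrary: \<xi> rule: par.induct) (auto simp: ren_inst intro: par.intros)

lemma par_sub:
  assumes "par t t'" and "\<And>v. par (\<sigma> v) (\<sigma>' v)"
  shows "par (sub \<sigma> t) (sub \<sigma>' t')"
  using assms
proof (induction arbitrary: \<sigma> \<sigma>' rule: par.induct)
  case (par_Ab t t')
  have "par (up \<sigma> v) (up \<sigma>' v)" for v
    using par_Ab.prems by (cases v rule: vr_cases) (auto intro: par_ren)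
  then show ?case using par_Ab.IH by (auto intro: par.intros)
next
  case (par_beta t t' u u')
  have "par (up \<sigma> v) (up \<sigma>' v)" for v
    using par_beta.prems by (cases v rule: vr_cases) (auto intro: par_ren)
  then show ?case using par_beta.IH par_beta.prems by (auto simp: sub_inst intro: par.intros)
qed (auto intro: par.intros)

lemma par_inst: "par t t' \<Longrightarrow> par u u' \<Longrightarrow> par (inst t u) (inst t' u')"
  unfolding inst_def by (erule par_sub) (rule_tac v = v in vr_cases, auto)

text \<open>Complete developments, for Takahashi's proof of confluence.\<close>

fun cd :: "lt \<Rightarrow> lt" where
  "cd (Cst c) = Cst c"
| "cd (Vr v) = Vr v"
| "cd (Ab t) = Ab (cd t)"
| "cd (Ap (Ab t) u) = inst (cd t) (cd u)"
| "cd (Ap t u) = Ap (cd t) (cd u)"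

text \<open>\<open>cd t\<close> contracts every redex present in \<open>t\<close>, so a parallel
  step can be completed by contracting what it left out. Any two steps from \<open>t\<close>
  therefore meet in \<open>cd t\<close>.\<close>

lemma par_cd: "par t t' \<Longrightarrow> par t' (cd t)"
proof (induction rule: par.induct)
  case (par_Ap t t' u u')
  show ?case
  proof (cases t)
    case (Ab s)
    with par_Ap.hyps(1) obtain s' where "t' = Ab s'" by (auto elim: par_AbE)
    with par_Ap Ab show ?thesis by (auto elim: par_AbE intro: par.intros)
  qed (use par_Ap in \<open>auto intro: par.intros\<close>)
qed (auto intro: par.intros par_inst)

abbreviation red :: "lt \<Rightarrow> lt \<Rightarrow> bool" where
  "red \<equiv> par\<^sup>*\<^sup>*"

lemma par_strip: "red t u \<Longrightarrow> par t s \<Longrightarrow> \<exists>r. par u r \<and> red s r"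
proof (induction rule: rtranclp_induct)
  case base
  then show ?case by blast
next
  case (step y z)
  then obtain r where "par y r" "red s r" by blast
  with step.hyps(2) show ?case by (meson par_cd rtranclp.rtrancl_into_rtrancl)
qed

lemma red_confluent: "red t s \<Longrightarrow> red t u \<Longrightarrow> \<exists>r. red u r \<and> red s r"
proof (induction rule: rtranclp_induct)
  case base
  then show ?case by blast
next
  case (step y z)
  then obtain r where "red u r" "red y r" by blast
  with par_strip[OF \<open>red y r\<close> step.hyps(2)] show ?case
    by (meson rtranclp.rtrancl_into_rtrancl)
qed

text \<open>\<open>par\<close> is reflexive, so normality asks that every step be trivial. A redex
  that reproduces itself would qualify too, which does no harm to uniqueness of normal
  forms.\<close>

definition nf :: "lt \<Rightarrow> bool" where
  "nf t \<longleftrightarrow> (\<forall>u. par t u \<longrightarrow> u = t)"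

lemma nf_red: "red t u \<Longrightarrow> nf t \<Longrightarrow> u = t"
  by (induction rule: rtranclp_induct) (auto simp: nf_def)

text \<open>By confluence a normal form stays reachable from every reduct;
  \<open>red_sub_inst\<close> uses this to switch between two routes from one term.\<close>

lemma red_nf: "red t n \<Longrightarrow> nf n \<Longrightarrow> red t u \<Longrightarrow> red u n"
  by (metis red_confluent nf_red)

lemma red_nf_unique: "red t m \<Longrightarrow> red t n \<Longrightarrow> nf m \<Longrightarrow> nf n \<Longrightarrow> m = n"
  by (metis red_nf nf_red)

lemma red_map: "(\<And>t u. par t u \<Longrightarrow> par (f t) (f u)) \<Longrightarrow> red t u \<Longrightarrow> red (f t) (f u)"
  by (erule rtranclp_induct) (auto intro: rtranclp.rtrancl_into_rtrancl)

lemma red_Ab: "red t t' \<Longrightarrow> red (Ab t) (Ab t')"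
  by (rule red_map) (auto intro: par_Ab)

lemma red_Ap: "red t t' \<Longrightarrow> red u u' \<Longrightarrow> red (Ap t u) (Ap t' u')"
  by (rule rtranclp_trans[of _ _ "Ap t' u"]; rule red_map) (auto intro: par_Ap)

lemma red_ren: "red t t' \<Longrightarrow> red (ren \<xi> t) (ren \<xi> t')"
  by (rule red_map) (auto intro: par_ren)

lemma red_sub: "red t t' \<Longrightarrow> red (sub \<sigma> t) (sub \<sigma> t')"
  by (rule red_map) (auto intro: par_sub)

lemma red_inst: "red t t' \<Longrightarrow> red u u' \<Longrightarrow> red (inst t u) (inst t' u')"
  by (rule rtranclp_trans[of _ _ "inst t' u"]; rule red_map) (auto intro: par_inst)

lemma red_beta: "red t (Ab s) \<Longrightarrow> red u u' \<Longrightarrow> red (Ap t u) (inst s u')"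
  by (rule rtranclp.rtrancl_into_rtrancl[of _ _ "Ap (Ab s) u'"]) (auto intro: red_Ap par.intros)

section \<open>Embedding of the canonical expressions\<close>

primrec emb_tm :: "tm \<Rightarrow> lt" and emb_atm :: "atm \<Rightarrow> lt" where
  "emb_tm (Atm R) = emb_atm R"
| "emb_tm (LamB M) = Ab (emb_tm M)"
| "emb_atm (Const c) = Cst (CObj c)"
| "emb_atm (FVar x) = Vr (Nm x)"
| "emb_atm (BVar i) = Vr (Ix i)"
| "emb_atm (App R M) = Ap (emb_atm R) (emb_tm M)"

primrec emb_aty :: "aty \<Rightarrow> lt" where
  "emb_aty (TConst a) = Cst (CTy a)"
| "emb_aty (TApp P M) = Ap (emb_aty P) (emb_tm M)"

primrec emb_ty :: "ty \<Rightarrow> lt" where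
  "emb_ty (Base P) = emb_aty P"
| "emb_ty (PiB A B) = Ap (Ap (Cst CPi) (emb_ty A)) (Ab (emb_ty B))"

primrec emb_kd :: "kd \<Rightarrow> lt" where
  "emb_kd Type = Cst CType"
| "emb_kd (KPiB A K) = Ap (Ap (Cst CKPi) (emb_ty A)) (Ab (emb_kd K))"

lemma emb_atm_neq_Ab [simp]: "emb_atm R \<noteq> Ab t" "Ab t \<noteq> emb_atm R"
  by (cases R; simp)+

text \<open>The embedding does not mark \<open>Base\<close>. Atomic types and products are still
  told apart, because the former have a type constant at the head and the latter
  \<open>CPi\<close>.\<close>

lemma emb_aty_neq [simp]:
  "emb_aty P \<noteq> Ab t" "emb_aty P \<noteq> Ap (Ap (Cst CPi) t) u" "emb_aty P \<noteq> Cst CPi"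
  "Ap (Ap (Cst CPi) t) u \<noteq> emb_aty P"
proof -
  show 1: "emb_aty P \<noteq> Cst CPi" for P by (cases P) auto
  have 2: "emb_aty P \<noteq> Ap (Cst CPi) t" for P t using 1 by (cases P) auto
  show 3: "emb_aty P \<noteq> Ap (Ap (Cst CPi) t) u" using 2 by (cases P) auto
  show "Ap (Ap (Cst CPi) t) u \<noteq> emb_aty P" using 3 by metis
  show "emb_aty P \<noteq> Ab t" by (cases P) auto
qed

lemma emb_tm_inj_aux:
  "emb_tm M = emb_tm M' \<Longrightarrow> M = M'"
  "emb_atm R = emb_atm R' \<Longrightarrow> R = R'"
proof (induction M and R arbitrary: M' and R')
  case (Atm R) then show ?case by (cases M') auto
next
  case (LamB M) then show ?case by (cases M') auto
next
  case (Const c) then show ?case by (cases R') auto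
next
  case (FVar x) then show ?case by (cases R') auto
next
  case (BVar x) then show ?case by (cases R') auto
next
  case (App R M) then show ?case by (cases R') auto
qed

lemma emb_tm_inj [simp]: "emb_tm M = emb_tm M' \<longleftrightarrow> M = M'"
  using emb_tm_inj_aux by blast

lemma emb_atm_inj [simp]: "emb_atm R = emb_atm R' \<longleftrightarrow> R = R'"
  using emb_tm_inj_aux by blast

lemma emb_aty_inj [simp]: "emb_aty P = emb_aty P' \<longleftrightarrow> P = P'"
proof (induction P arbitrary: P')
  case (TConst a) then show ?case by (cases P') auto
next
  case (TApp P M) then show ?case by (cases P') auto
qed

lemma emb_ty_inj [simp]: "emb_ty A = emb_ty A' \<longleftrightarrow> A = A'"
proof (induction A arbitrary: A')
  case (Base P) then show ?case by (cases A') auto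
next
  case (PiB A B) then show ?case by (cases A') auto
qed

lemma emb_kd_inj [simp]: "emb_kd K = emb_kd K' \<longleftrightarrow> K = K'"
proof (induction K arbitrary: K')
  case Type then show ?case by (cases K') auto
next
  case (KPiB A K) then show ?case by (cases K') auto
qed

lemma nf_Ap_iff: "nf t \<Longrightarrow> nf u \<Longrightarrow> \<forall>s. t \<noteq> Ab s \<Longrightarrow> nf (Ap t u)"
  unfolding nf_def by (auto elim!: par_ApE)

lemma nf_Ab: "nf t \<Longrightarrow> nf (Ab t)"
  unfolding nf_def by (auto elim!: par_AbE)

lemma nf_Cst: "nf (Cst c)"
  unfolding nf_def by (auto elim!: par_CstE)

lemma nf_Vr: "nf (Vr v)"
  unfolding nf_def by (auto elim!: par_VrE)

text \<open>The function part of an application is atomic, hence never an abstraction: canonical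
  syntax leaves no room for a redex.\<close>

lemma nf_emb_tm [simp]: "nf (emb_tm M)" and nf_emb_atm [simp]: "nf (emb_atm R)"
  by (induction M and R) (auto intro: nf_Ap_iff nf_Ab nf_Cst nf_Vr)

lemma nf_emb_aty [simp]: "nf (emb_aty P)"
  by (induction P) (auto intro: nf_Ap_iff nf_Cst)

lemma nf_emb_ty [simp]: "nf (emb_ty A)"
  by (induction A) (auto intro!: nf_Ap_iff nf_Ab nf_Cst)

lemma nf_emb_kd [simp]: "nf (emb_kd K)"
  by (induction K) (auto intro!: nf_Ap_iff nf_Ab nf_Cst)

lemma red_emb_ty_unique: "red t (emb_ty A) \<Longrightarrow> red t (emb_ty B) \<Longrightarrow> A = B"
  using red_nf_unique nf_emb_ty emb_ty_inj by blast

lemma red_emb_tm_unique: "red t (emb_tm A) \<Longrightarrow> red t (emb_tm B) \<Longrightarrow> A = B"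
  using red_nf_unique nf_emb_tm emb_tm_inj by blast

lemma red_emb_kd_unique: "red t (emb_kd A) \<Longrightarrow> red t (emb_kd B) \<Longrightarrow> A = B"
  using red_nf_unique nf_emb_kd emb_kd_inj by blast

section \<open>Named binders as renamings\<close>

definition absr :: "var \<Rightarrow> vr \<Rightarrow> vr" where
  "absr x v = (if v = Nm x then Ix 0 else shift v)"

lemma absr_simps [simp]: "absr x (Nm y) = (if y = x then Ix 0 else Nm y)" "absr x (Ix i) = Ix (Suc i)"
  by (auto simp: absr_def)

lemma upr_pow_Ix: "(upr ^^ k) (absr x) (Ix i) = Ix (if i < k then i else Suc i)"
proof (induction k arbitrary: i)
  case (Suc k)
  then show ?case by (cases i) auto
qed auto

lemma upr_pow_Nm: "(upr ^^ k) (absr x) (Nm y) = (if y = x then Ix k else Nm y)"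
  by (induction k) auto

text \<open>Under \<open>k\<close> binders abstraction acts as \<open>absr x\<close> lifted
  \<open>k\<close> times, which brings the index arithmetic of \<open>abs_tm\<close> under the
  general laws for \<open>ren\<close>.\<close>

lemma emb_abs_tm: "emb_tm (abs_tm k x M) = ren ((upr ^^ k) (absr x)) (emb_tm M)"
  and emb_abs_atm: "emb_atm (abs_atm k x R) = ren ((upr ^^ k) (absr x)) (emb_atm R)"
  by (induction M and R arbitrary: k and k) (auto simp: upr_pow_Ix upr_pow_Nm)

lemma emb_abs_aty: "emb_aty (abs_aty k x P) = ren ((upr ^^ k) (absr x)) (emb_aty P)"
  by (induction P) (auto simp: emb_abs_tm)

lemma emb_abs_ty: "emb_ty (abs_ty k x A) = ren ((upr ^^ k) (absr x)) (emb_ty A)"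
  by (induction A arbitrary: k) (auto simp: emb_abs_aty)

lemma emb_abs_kd: "emb_kd (abs_kd k x K) = ren ((upr ^^ k) (absr x)) (emb_kd K)"
  by (induction K arbitrary: k) (auto simp: emb_abs_ty)

lemma emb_lam: "emb_tm (lam x M) = Ab (ren (absr x) (emb_tm M))"
  by (simp add: lam_def emb_abs_tm)

text \<open>The bridge between two uses of a binder: contraction with the raw body is ordinary
  substitution for the name that was abstracted.\<close>

lemma inst_absr: "inst (ren (absr x) t) u = sub (Vr(Nm x := u)) t"
proof -
  have "vcons u Vr \<circ> absr x = Vr(Nm x := u)"
    by (rule ext, rule_tac v = xa in vr_cases) auto
  then show ?thesis by (simp add: inst_def sub_ren)
qed

text \<open>Opening the next binder under \<sigma> just adds an entry to \<sigma>. No freshness of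
  \<open>x\<close> or \<open>u\<close> is asked, since after abstraction \<open>x\<close> is an
  index that \<open>up \<sigma>\<close> fixes. This turns the one-argument steps of a spine into a
  simultaneous substitution.\<close>

lemma inst_up_absr: "inst (sub (up \<sigma>) (ren (absr x) t)) u = sub (\<sigma>(Nm x := u)) t"
proof -
  have "sub (vcons u Vr) \<circ> (up \<sigma> \<circ> absr x) = \<sigma>(Nm x := u)"
    by (rule ext, rule_tac v = xa in vr_cases) auto
  then show ?thesis by (simp add: inst_def sub_ren sub_sub)
qed

text \<open>A substitution that passes under a binder may rename it from \<open>x\<close> to
  \<open>z\<close>. The only danger is that \<open>z\<close> already occurs in what is substituted
  for the other variables.\<close>

lemma up_absr_fresh:
  assumes "\<And>i. \<sigma> (Ix i) = Vr (Ix i)"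
    and "\<And>v. v \<in> fv t \<Longrightarrow> v \<noteq> Nm x \<Longrightarrow> Nm z \<notin> fv (\<sigma> v)"
  shows "sub (up \<sigma>) (ren (absr x) t) = ren (absr z) (sub (\<sigma>(Nm x := Vr (Nm z))) t)"
proof -
  have "(up \<sigma> \<circ> absr x) v = (ren (absr z) \<circ> \<sigma>(Nm x := Vr (Nm z))) v" if "v \<in> fv t" for v
  proof (cases "v = Nm x")
    case False
    then have "(up \<sigma> \<circ> absr x) v = ren shift (\<sigma> v)"
      using assms(1) by (auto simp: absr_def)
    also have "\<dots> = ren (absr z) (\<sigma> v)"
      using assms(2)[OF that False] by (intro ren_cong_fv) (auto simp: absr_def)
    finally show ?thesis using False by simp
  qed auto
  then show ?thesis by (simp add: sub_ren ren_sub cong: sub_cong_fv)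
qed

section \<open>Arity typing\<close>

text \<open>\<Theta> gives arities to names and \<Delta> to indices. Atomic terms are canonical only
  at arity \<open>Obj\<close>, so terms are eta-long: at an arrow arity a term must be an
  abstraction, which is what the rule \<open>red_app\<close> asks of its reduced head.\<close>

primrec wt_tm :: "(oconst \<times> arity) set \<Rightarrow> (var \<times> arity) set \<Rightarrow> arity list \<Rightarrow> tm \<Rightarrow> arity \<Rightarrow> bool"
  and wt_atm :: "(oconst \<times> arity) set \<Rightarrow> (var \<times> arity) set \<Rightarrow> arity list \<Rightarrow> atm \<Rightarrow> arity \<Rightarrow> bool" where
  "wt_tm S \<Theta> \<Delta> (Atm R) \<alpha> \<longleftrightarrow> \<alpha> = Obj \<and> wt_atm S \<Theta> \<Delta> R Obj"
| "wt_tm S \<Theta> \<Delta> (LamB M) \<alpha> \<longleftrightarrow> (\<exists>\<beta> \<gamma>. \<alpha> = Arr \<beta> \<gamma> \<and> wt_tm S \<Theta> (\<beta> # \<Delta>) M \<gamma>)"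
| "wt_atm S \<Theta> \<Delta> (Const c) \<alpha> \<longleftrightarrow> (c, \<alpha>) \<in> S"
| "wt_atm S \<Theta> \<Delta> (FVar x) \<alpha> \<longleftrightarrow> (x, \<alpha>) \<in> \<Theta>"
| "wt_atm S \<Theta> \<Delta> (BVar i) \<alpha> \<longleftrightarrow> i < length \<Delta> \<and> \<Delta> ! i = \<alpha>"
| "wt_atm S \<Theta> \<Delta> (App R M) \<alpha> \<longleftrightarrow> (\<exists>\<beta>. wt_atm S \<Theta> \<Delta> R (Arr \<beta> \<alpha>) \<and> wt_tm S \<Theta> \<Delta> M \<beta>)"

text \<open>
  Hereditary substitution never reduces at the head of an atomic type, so the arities of its
  arguments need not match the kind of the type constant.
\<close>

primrec wt_aty :: "(oconst \<times> arity) set \<Rightarrow> (var \<times> arity) set \<Rightarrow> arity list \<Rightarrow> aty \<Rightarrow> bool" where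
  "wt_aty S \<Theta> \<Delta> (TConst a) \<longleftrightarrow> True"
| "wt_aty S \<Theta> \<Delta> (TApp P M) \<longleftrightarrow> wt_aty S \<Theta> \<Delta> P \<and> (\<exists>\<beta>. wt_tm S \<Theta> \<Delta> M \<beta>)"

primrec wt_ty :: "(oconst \<times> arity) set \<Rightarrow> (var \<times> arity) set \<Rightarrow> arity list \<Rightarrow> ty \<Rightarrow> bool" where
  "wt_ty S \<Theta> \<Delta> (Base P) \<longleftrightarrow> wt_aty S \<Theta> \<Delta> P"
| "wt_ty S \<Theta> \<Delta> (PiB A B) \<longleftrightarrow> wt_ty S \<Theta> \<Delta> A \<and> wt_ty S \<Theta> (erase A # \<Delta>) B"

primrec wt_kd :: "(oconst \<times> arity) set \<Rightarrow> (var \<times> arity) set \<Rightarrow> arity list \<Rightarrow> kd \<Rightarrow> bool" where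
  "wt_kd S \<Theta> \<Delta> Type \<longleftrightarrow> True"
| "wt_kd S \<Theta> \<Delta> (KPiB A K) \<longleftrightarrow> wt_ty S \<Theta> \<Delta> A \<and> wt_kd S \<Theta> (erase A # \<Delta>) K"

section \<open>Weakening, abstraction and opening for arity typing\<close>

lemma wt_mono_tm: "wt_tm S \<Theta> \<Delta> M \<alpha> \<Longrightarrow> S \<subseteq> S' \<Longrightarrow> \<Theta> \<subseteq> \<Theta>' \<Longrightarrow> wt_tm S' \<Theta>' \<Delta> M \<alpha>"
  and wt_mono_atm: "wt_atm S \<Theta> \<Delta> R \<alpha> \<Longrightarrow> S \<subseteq> S' \<Longrightarrow> \<Theta> \<subseteq> \<Theta>' \<Longrightarrow> wt_atm S' \<Theta>' \<Delta> R \<alpha>"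
proof (induction M and R arbitrary: \<Delta> \<alpha> and \<Delta> \<alpha>)
  case (App R M)
  then show ?case by simp blast
qed auto

lemma wt_mono_aty: "wt_aty S \<Theta> \<Delta> P \<Longrightarrow> S \<subseteq> S' \<Longrightarrow> \<Theta> \<subseteq> \<Theta>' \<Longrightarrow> wt_aty S' \<Theta>' \<Delta> P"
  by (induction P) (auto intro: wt_mono_tm)

lemma wt_mono_ty: "wt_ty S \<Theta> \<Delta> A \<Longrightarrow> S \<subseteq> S' \<Longrightarrow> \<Theta> \<subseteq> \<Theta>' \<Longrightarrow> wt_ty S' \<Theta>' \<Delta> A"
  by (induction A arbitrary: \<Delta>) (auto intro: wt_mono_aty)

lemma wt_mono_kd: "wt_kd S \<Theta> \<Delta> K \<Longrightarrow> S \<subseteq> S' \<Longrightarrow> \<Theta> \<subseteq> \<Theta>' \<Longrightarrow> wt_kd S' \<Theta>' \<Delta> K"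
  by (induction K arbitrary: \<Delta>) (auto intro: wt_mono_ty)

lemma erase_abs [simp]: "erase (abs_ty k x A) = erase A"
  by (induction A arbitrary: k) auto

text \<open>\<Theta> is a relation. The side condition excludes a second arity for \<open>x\<close>,
  which the single index replacing \<open>x\<close> could not have.\<close>

lemma wt_abs_tm: "x \<notin> fst ` \<Theta> \<Longrightarrow> wt_tm S (insert (x, \<beta>) \<Theta>) (\<Delta>1 @ \<Delta>2) M \<alpha>
    \<Longrightarrow> wt_tm S \<Theta> (\<Delta>1 @ \<beta> # \<Delta>2) (abs_tm (length \<Delta>1) x M) \<alpha>"
  and wt_abs_atm: "x \<notin> fst ` \<Theta> \<Longrightarrow> wt_atm S (insert (x, \<beta>) \<Theta>) (\<Delta>1 @ \<Delta>2) R \<alpha>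
    \<Longrightarrow> wt_atm S \<Theta> (\<Delta>1 @ \<beta> # \<Delta>2) (abs_atm (length \<Delta>1) x R) \<alpha>"
proof (induction M and R arbitrary: \<Delta>1 \<alpha> and \<Delta>1 \<alpha>)
  case (LamB M)
  then obtain \<gamma> \<delta> where "\<alpha> = Arr \<gamma> \<delta>" "wt_tm S (insert (x, \<beta>) \<Theta>) ((\<gamma> # \<Delta>1) @ \<Delta>2) M \<delta>" by auto
  with LamB.IH[of "\<gamma> # \<Delta>1" \<delta>] LamB.prems show ?case by auto
next
  case (BVar i)
  then show ?case by (auto simp: nth_append Suc_diff_le)
next
  case (App R M)
  then show ?case by simp blast
qed force+

lemma wt_abs_aty: "x \<notin> fst ` \<Theta> \<Longrightarrow> wt_aty S (insert (x, \<beta>) \<Theta>) (\<Delta>1 @ \<Delta>2) P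
    \<Longrightarrow> wt_aty S \<Theta> (\<Delta>1 @ \<beta> # \<Delta>2) (abs_aty (length \<Delta>1) x P)"
  by (induction P) (auto intro: wt_abs_tm)

lemma wt_abs_ty: "x \<notin> fst ` \<Theta> \<Longrightarrow> wt_ty S (insert (x, \<beta>) \<Theta>) (\<Delta>1 @ \<Delta>2) A
    \<Longrightarrow> wt_ty S \<Theta> (\<Delta>1 @ \<beta> # \<Delta>2) (abs_ty (length \<Delta>1) x A)"
proof (induction A arbitrary: \<Delta>1)
  case (PiB A B)
  from PiB.IH(2)[of "erase A # \<Delta>1"] PiB.IH(1)[of \<Delta>1] PiB.prems show ?case by simp
qed (auto intro: wt_abs_aty)

lemma wt_abs_kd: "x \<notin> fst ` \<Theta> \<Longrightarrow> wt_kd S (insert (x, \<beta>) \<Theta>) (\<Delta>1 @ \<Delta>2) K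
    \<Longrightarrow> wt_kd S \<Theta> (\<Delta>1 @ \<beta> # \<Delta>2) (abs_kd (length \<Delta>1) x K)"
proof (induction K arbitrary: \<Delta>1)
  case (KPiB A K)
  from KPiB.IH[of "erase A # \<Delta>1"] KPiB.prems wt_abs_ty[of x \<Theta> S \<beta> \<Delta>1 \<Delta>2 A] show ?case by simp
qed auto

lemma wt_unabs_tm: "wt_tm S \<Theta> (\<Delta>1 @ \<beta> # \<Delta>2) (abs_tm (length \<Delta>1) x M) \<alpha>
    \<Longrightarrow> wt_tm S (insert (x, \<beta>) \<Theta>) (\<Delta>1 @ \<Delta>2) M \<alpha>"
  and wt_unabs_atm: "wt_atm S \<Theta> (\<Delta>1 @ \<beta> # \<Delta>2) (abs_atm (length \<Delta>1) x R) \<alpha>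
    \<Longrightarrow> wt_atm S (insert (x, \<beta>) \<Theta>) (\<Delta>1 @ \<Delta>2) R \<alpha>"
proof (induction M and R arbitrary: \<Delta>1 \<alpha> and \<Delta>1 \<alpha>)
  case (LamB M)
  then obtain \<gamma> \<delta> where "\<alpha> = Arr \<gamma> \<delta>" "wt_tm S \<Theta> ((\<gamma> # \<Delta>1) @ \<beta> # \<Delta>2) (abs_tm (length (\<gamma> # \<Delta>1)) x M) \<delta>"
    by auto
  with LamB.IH[of "\<gamma> # \<Delta>1" \<delta>] show ?case by auto
next
  case (BVar i)
  then show ?case by (auto simp: nth_append Suc_diff_le split: if_splits)
next
  case (App R M)
  then show ?case by simp blast
qed (auto split: if_splits)

lemma wt_unabs_aty: "wt_aty S \<Theta> (\<Delta>1 @ \<beta> # \<Delta>2) (abs_aty (length \<Delta>1) x P)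
    \<Longrightarrow> wt_aty S (insert (x, \<beta>) \<Theta>) (\<Delta>1 @ \<Delta>2) P"
  by (induction P) (auto intro: wt_unabs_tm)

lemma wt_unabs_ty: "wt_ty S \<Theta> (\<Delta>1 @ \<beta> # \<Delta>2) (abs_ty (length \<Delta>1) x A)
    \<Longrightarrow> wt_ty S (insert (x, \<beta>) \<Theta>) (\<Delta>1 @ \<Delta>2) A"
proof (induction A arbitrary: \<Delta>1)
  case (PiB A B)
  from PiB.IH(2)[of "erase A # \<Delta>1"] PiB.IH(1)[of \<Delta>1] PiB.prems show ?case by simp
qed (auto intro: wt_unabs_aty)

lemma wt_unabs_kd: "wt_kd S \<Theta> (\<Delta>1 @ \<beta> # \<Delta>2) (abs_kd (length \<Delta>1) x K)
    \<Longrightarrow> wt_kd S (insert (x, \<beta>) \<Theta>) (\<Delta>1 @ \<Delta>2) K"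
proof (induction K arbitrary: \<Delta>1)
  case (KPiB A K)
  from KPiB.IH[of "erase A # \<Delta>1"] KPiB.prems wt_unabs_ty[of S \<Theta> \<Delta>1 \<beta> \<Delta>2 x A] show ?case by simp
qed auto

lemma wt_lam: "x \<notin> fst ` \<Theta> \<Longrightarrow> wt_tm S (insert (x, \<beta>) \<Theta>) [] M \<gamma> \<Longrightarrow> wt_tm S \<Theta> [] (lam x M) (Arr \<beta> \<gamma>)"
  using wt_abs_tm[of x \<Theta> S \<beta> "[]" "[]"] by (simp add: lam_def)

lemma wt_pi: "x \<notin> fst ` \<Theta> \<Longrightarrow> wt_ty S \<Theta> [] A \<Longrightarrow> wt_ty S (insert (x, erase A) \<Theta>) [] B
    \<Longrightarrow> wt_ty S \<Theta> [] (pi x A B)"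
  using wt_abs_ty[of x \<Theta> S _ "[]" "[]"] by (simp add: pi_def)

lemma wt_kpi: "x \<notin> fst ` \<Theta> \<Longrightarrow> wt_ty S \<Theta> [] A \<Longrightarrow> wt_kd S (insert (x, erase A) \<Theta>) [] K
    \<Longrightarrow> wt_kd S \<Theta> [] (kpi x A K)"
  using wt_abs_kd[of x \<Theta> S _ "[]" "[]"] by (simp add: kpi_def)

lemma wt_lamD: "wt_tm S \<Theta> [] (lam x M) (Arr \<beta> \<gamma>) \<Longrightarrow> wt_tm S (insert (x, \<beta>) \<Theta>) [] M \<gamma>"
  using wt_unabs_tm[of S \<Theta> "[]" \<beta> "[]" x M \<gamma>] by (simp add: lam_def)

lemma wt_piD:
  assumes "wt_ty S \<Theta> [] (pi x A B)"
  shows "wt_ty S \<Theta> [] A" "wt_ty S (insert (x, erase A) \<Theta>) [] B"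
  using assms wt_unabs_ty[of S \<Theta> "[]" "erase A" "[]" x B] by (auto simp: pi_def)

lemma wt_kpiD:
  assumes "wt_kd S \<Theta> [] (kpi x A K)"
  shows "wt_ty S \<Theta> [] A" "wt_kd S (insert (x, erase A) \<Theta>) [] K"
  using assms wt_unabs_kd[of S \<Theta> "[]" "erase A" "[]" x K] by (auto simp: kpi_def)

abbreviation scope :: "(var \<times> arity) set \<Rightarrow> arity list \<Rightarrow> vr set" where
  "scope \<Theta> \<Delta> \<equiv> Nm ` fst ` \<Theta> \<union> Ix ` {..<length \<Delta>}"

lemma scope_Ab: "fv t \<subseteq> scope \<Theta> (\<beta> # \<Delta>) \<Longrightarrow> fv (Ab t) \<subseteq> scope \<Theta> \<Delta>"
proof
  fix v assume *: "fv t \<subseteq> scope \<Theta> (\<beta> # \<Delta>)" "v \<in> fv (Ab t)"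
  then show "v \<in> scope \<Theta> \<Delta>" by (cases v) auto
qed

lemma wt_fv_tm: "wt_tm S \<Theta> \<Delta> M \<alpha> \<Longrightarrow> fv (emb_tm M) \<subseteq> scope \<Theta> \<Delta>"
  and wt_fv_atm: "wt_atm S \<Theta> \<Delta> R \<alpha> \<Longrightarrow> fv (emb_atm R) \<subseteq> scope \<Theta> \<Delta>"
proof (induction M and R arbitrary: \<Delta> \<alpha> and \<Delta> \<alpha>)
  case (LamB M)
  then obtain \<beta> \<gamma> where "wt_tm S \<Theta> (\<beta> # \<Delta>) M \<gamma>" by auto
  from scope_Ab[OF LamB.IH[OF this]] show ?case by simp
next
  case (App R M)
  then obtain \<beta> where wt: "wt_atm S \<Theta> \<Delta> R (Arr \<beta> \<alpha>)" "wt_tm S \<Theta> \<Delta> M \<beta>" by auto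
  from App.IH(1)[OF wt(1)] App.IH(2)[OF wt(2)] show ?case by simp
qed (auto intro: rev_image_eqI)

lemma wt_fv_aty: "wt_aty S \<Theta> \<Delta> P \<Longrightarrow> fv (emb_aty P) \<subseteq> scope \<Theta> \<Delta>"
  by (induction P) (auto dest!: wt_fv_tm)

lemma wt_fv_ty: "wt_ty S \<Theta> \<Delta> A \<Longrightarrow> fv (emb_ty A) \<subseteq> scope \<Theta> \<Delta>"
proof (induction A arbitrary: \<Delta>)
  case (PiB A B)
  then have "wt_ty S \<Theta> \<Delta> A" "wt_ty S \<Theta> (erase A # \<Delta>) B" by auto
  from PiB.IH(1)[OF this(1)] scope_Ab[OF PiB.IH(2)[OF this(2)]] show ?case by simp
qed (simp add: wt_fv_aty)

lemma wt_fv_kd: "wt_kd S \<Theta> \<Delta> K \<Longrightarrow> fv (emb_kd K) \<subseteq> scope \<Theta> \<Delta>"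
proof (induction K arbitrary: \<Delta>)
  case (KPiB A K)
  then have "wt_ty S \<Theta> \<Delta> A" "wt_kd S \<Theta> (erase A # \<Delta>) K" by auto
  from wt_fv_ty[OF this(1)] scope_Ab[OF KPiB.IH[OF this(2)]] show ?case by simp
qed simp

section \<open>Choosing names for binders\<close>

lemma Ix_cases: "(i < k \<Longrightarrow> P) \<Longrightarrow> (i = k \<Longrightarrow> P) \<Longrightarrow> (\<And>j. i = Suc j \<Longrightarrow> k \<le> j \<Longrightarrow> P) \<Longrightarrow> P" for i k :: nat
  by (metis less_Suc_eq_le less_imp_Suc_add linorder_neqE_nat not_less_eq le_add1)

text \<open>Preimages under abstraction are found by opening: index \<open>k\<close> becomes
  \<open>x\<close>, larger indices go down by one. A free \<open>x\<close> already present would be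
  captured by abstracting again.\<close>

lemma ex_abs_tm: "Nm x \<notin> fv (emb_tm M) \<Longrightarrow> \<exists>M'. abs_tm k x M' = M"
  and ex_abs_atm: "Nm x \<notin> fv (emb_atm R) \<Longrightarrow> \<exists>R'. abs_atm k x R' = R"
proof (induction M and R arbitrary: k and k)
  case (Atm R)
  then obtain R' where "abs_atm k x R' = R" by auto
  then have "abs_tm k x (Atm R') = Atm R" by simp
  then show ?case by blast
next
  case (LamB M)
  then obtain M' where "abs_tm (Suc k) x M' = M" by auto
  then have "abs_tm k x (LamB M') = LamB M" by simp
  then show ?case by blast
next
  case (Const c)
  have "abs_atm k x (Const c) = Const c" by simp
  then show ?case by blast
next
  case (FVar y)
  then have "abs_atm k x (FVar y) = FVar y" by simp
  then show ?case by blast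
next
  case (BVar i)
  show ?case
  proof (cases rule: Ix_cases[of i k])
    case 1
    then have "abs_atm k x (BVar i) = BVar i" by simp
    then show ?thesis by blast
  next
    case 2
    then have "abs_atm k x (FVar x) = BVar i" by simp
    then show ?thesis by blast
  next
    case (3 j)
    then have "abs_atm k x (BVar j) = BVar i" by simp
    then show ?thesis by blast
  qed
next
  case (App R M)
  then obtain R' M' where "abs_atm k x R' = R" "abs_tm k x M' = M" by fastforce
  then have "abs_atm k x (App R' M') = App R M" by simp
  then show ?case by blast
qed

lemma ex_abs_aty: "Nm x \<notin> fv (emb_aty P) \<Longrightarrow> \<exists>P'. abs_aty k x P' = P"
proof (induction P)
  case (TConst a)
  have "abs_aty k x (TConst a) = TConst a" by simp
  then show ?case by blast
next
  case (TApp P M)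
  then obtain P' M' where "abs_aty k x P' = P" "abs_tm k x M' = M" using ex_abs_tm by fastforce
  then have "abs_aty k x (TApp P' M') = TApp P M" by simp
  then show ?case by blast
qed

lemma ex_abs_ty: "Nm x \<notin> fv (emb_ty A) \<Longrightarrow> \<exists>A'. abs_ty k x A' = A"
proof (induction A arbitrary: k)
  case (Base P)
  then obtain P' where "abs_aty k x P' = P" using ex_abs_aty by fastforce
  then have "abs_ty k x (Base P') = Base P" by simp
  then show ?case by blast
next
  case (PiB A B)
  then have "Nm x \<notin> fv (emb_ty B)" by auto
  with PiB obtain A' B' where "abs_ty k x A' = A" "abs_ty (Suc k) x B' = B" by fastforce
  then have "abs_ty k x (PiB A' B') = PiB A B" by simp
  then show ?case by blast
qed

lemma ex_abs_kd: "Nm x \<notin> fv (emb_kd K) \<Longrightarrow> \<exists>K'. abs_kd k x K' = K"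
proof (induction K arbitrary: k)
  case Type
  have "abs_kd k x Type = Type" by simp
  then show ?case by blast
next
  case (KPiB A K)
  then have "Nm x \<notin> fv (emb_kd K)" by auto
  with KPiB obtain A' K' where "abs_ty k x A' = A" "abs_kd (Suc k) x K' = K"
    using ex_abs_ty by fastforce
  then have "abs_kd k x (KPiB A' K') = KPiB A K" by simp
  then show ?case by blast
qed

text \<open>An opened body is not a subterm of the raw binder, but it has the size of one; the
  inductions through named binders run on size.\<close>

lemma size_abs_tm [simp]: "size (abs_tm k x M) = size M"
  and size_abs_atm [simp]: "size (abs_atm k x R) = size R"
  by (induction M and R arbitrary: k and k) auto

lemma size_abs_ty [simp]: "size (abs_ty k x A) = size A"
  by (induction A arbitrary: k) auto

lemma size_abs_kd [simp]: "size (abs_kd k x K) = size K"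
  by (induction K arbitrary: k) auto

lemma ex_fresh_var:
  assumes "finite X" "finite Y"
  shows "\<exists>x::var. x \<notin> X \<and> Nm x \<notin> Y"
proof -
  have "finite (Nm -` Y)" using assms(2) by (rule finite_vimageI) (auto intro: injI)
  with assms(1) obtain x where "x \<notin> X \<union> Nm -` Y"
    using ex_new_if_finite[OF infinite_UNIV_listI, of "X \<union> Nm -` Y"] by auto
  then show ?thesis by auto
qed

lemma fresh_lam: "finite X \<Longrightarrow> \<exists>x M. x \<notin> X \<and> LamB B = lam x M"
  using ex_fresh_var[OF _ finite_fv[of "emb_tm B"]] ex_abs_tm unfolding lam_def by metis

lemma fresh_pi: "finite X \<Longrightarrow> \<exists>x A2. x \<notin> X \<and> PiB A B = pi x A A2"
  using ex_fresh_var[OF _ finite_fv[of "emb_ty B"]] ex_abs_ty unfolding pi_def by metis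

lemma fresh_kpi: "finite X \<Longrightarrow> \<exists>x K2. x \<notin> X \<and> KPiB A K = kpi x A K2"
  using ex_fresh_var[OF _ finite_fv[of "emb_kd K"]] ex_abs_kd unfolding kpi_def by metis

section \<open>Hereditary substitution computes normal forms\<close>

text \<open>A set of triples need not be single-valued, so this is a relation; as
  \<open>emb_tm\<close> is injective, it can hold only if \<theta> has one term for each
  name.\<close>

definition agrees :: "(vr \<Rightarrow> lt) \<Rightarrow> subst \<Rightarrow> bool" where
  "agrees \<sigma> \<theta> \<longleftrightarrow> (\<forall>(x, M, \<alpha>) \<in> \<theta>. \<sigma> (Nm x) = emb_tm M) \<and> (\<forall>x. x \<notin> sdom \<theta> \<longrightarrow> \<sigma> (Nm x) = Vr (Nm x))
    \<and> (\<forall>i. \<sigma> (Ix i) = Vr (Ix i))"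

lemma agrees_single [simp]: "agrees (Vr(Nm x := emb_tm M)) {(x, M, \<alpha>)}"
  by (auto simp: agrees_def sdom_def)

lemma fv_emb_tm_Nm: "Nm x \<in> fv (emb_tm M) \<longleftrightarrow> x \<in> fv_tm M"
  and fv_emb_atm_Nm: "Nm x \<in> fv (emb_atm R) \<longleftrightarrow> x \<in> fv_atm R"
  by (induction M and R) auto

text \<open>In \<open>up_absr_fresh\<close> the name can stay \<open>x\<close>: freshness for
  \<theta> means that \<sigma> fixes \<open>x\<close> and that no other image contains it.\<close>

lemma sub_lam_fresh:
  assumes "agrees \<sigma> \<theta>" "fresh_for x \<theta>"
  shows "sub (up \<sigma>) (ren (absr x) t) = ren (absr x) (sub \<sigma> t)"
proof -
  have *: "Nm x \<notin> fv (\<sigma> v)" if "v \<noteq> Nm x" for v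
  proof (cases v)
    case (Nm y)
    show ?thesis
    proof (cases "y \<in> sdom \<theta>")
      case True
      then obtain M \<alpha> where "(y, M, \<alpha>) \<in> \<theta>" by (auto simp: sdom_def)
      with assms have "\<sigma> (Nm y) = emb_tm M" "x \<notin> fv_tm M" by (fastforce simp: agrees_def fresh_for_def)+
      with Nm show ?thesis by (simp add: fv_emb_tm_Nm)
    next
      case False
      with assms(1) Nm that show ?thesis by (auto simp: agrees_def)
    qed
  qed (use assms in \<open>auto simp: agrees_def\<close>)
  have "\<sigma>(Nm x := Vr (Nm x)) = \<sigma>"
    using assms by (intro ext) (auto simp: agrees_def fresh_for_def)
  moreover have "sub (up \<sigma>) (ren (absr x) t) = ren (absr x) (sub (\<sigma>(Nm x := Vr (Nm x))) t)"
    by (rule up_absr_fresh) (use assms * in \<open>auto simp: agrees_def\<close>)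
  ultimately show ?thesis by simp
qed

lemma hsub_sound_tm: "hsub_tm_h h \<theta> M M' \<Longrightarrow> agrees \<sigma> \<theta> \<Longrightarrow> red (sub \<sigma> (emb_tm M)) (emb_tm M')"
  and hsub_sound_atm: "hsub_atm_h h \<theta> R R' \<Longrightarrow> agrees \<sigma> \<theta> \<Longrightarrow> red (sub \<sigma> (emb_atm R)) (emb_atm R')"
  and hsub_sound_red: "hsub_red_h h \<theta> R M' \<alpha> \<Longrightarrow> agrees \<sigma> \<theta> \<Longrightarrow> red (sub \<sigma> (emb_atm R)) (emb_tm M')"
proof (induction arbitrary: \<sigma> and \<sigma> and \<sigma> rule: hsub_tm_h_hsub_atm_h_hsub_red_h.inducts)
  case (tm_lam x \<theta> h M M')
  then show ?case by (simp add: emb_lam sub_lam_fresh red_Ab red_ren)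
next
  case (red_app h1 \<theta> R x M' \<alpha>' \<alpha>'' h2 M M'' h3 M''')
  have "red (sub \<sigma> (emb_atm (App R M))) (inst (ren (absr x) (emb_tm M')) (emb_tm M''))"
    using red_app by (auto simp: emb_lam intro: red_beta)
  \<comment> \<open>Contracting the redex created at the head gives exactly the one-variable
    instance that the third premise normalises.\<close>
  also have "red (inst (ren (absr x) (emb_tm M')) (emb_tm M'')) (emb_tm M''')"
    unfolding inst_absr by (rule red_app.IH(3)) (rule agrees_single)
  finally show ?case .
qed (auto simp: agrees_def intro: red_Ap)

lemma hsub_sound_aty: "hsub_aty_h h \<theta> P P' \<Longrightarrow> agrees \<sigma> \<theta> \<Longrightarrow> red (sub \<sigma> (emb_aty P)) (emb_aty P')"
  by (induction rule: hsub_aty_h.induct) (auto intro: red_Ap hsub_sound_tm)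

lemma emb_pi: "emb_ty (pi x A B) = Ap (Ap (Cst CPi) (emb_ty A)) (Ab (ren (absr x) (emb_ty B)))"
  by (simp add: pi_def emb_abs_ty)

lemma emb_kpi: "emb_kd (kpi x A K) = Ap (Ap (Cst CKPi) (emb_ty A)) (Ab (ren (absr x) (emb_kd K)))"
  by (simp add: kpi_def emb_abs_kd)

lemma hsub_sound_ty: "hsub_ty_h h \<theta> A A' \<Longrightarrow> agrees \<sigma> \<theta> \<Longrightarrow> red (sub \<sigma> (emb_ty A)) (emb_ty A')"
  by (induction rule: hsub_ty_h.induct)
    (auto simp: emb_pi sub_lam_fresh intro!: red_Ap red_Ab red_ren hsub_sound_aty)

lemma hsub_sound_kd: "hsub_kd_h h \<theta> K K' \<Longrightarrow> agrees \<sigma> \<theta> \<Longrightarrow> red (sub \<sigma> (emb_kd K)) (emb_kd K')"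
  by (induction rule: hsub_kd_h.induct)
    (auto simp: emb_kpi sub_lam_fresh intro!: red_Ap red_Ab red_ren hsub_sound_ty)

section \<open>Hereditary substitution is total on arity-typed expressions\<close>

text \<open>Types \<theta> as a map from \<Theta> to \<Theta>', with \<open>n\<close> above the size
  of each arity of \<Theta> at which a term is substituted. This bound is the termination measure of
  hereditary substitution; finiteness supplies fresh binder names.\<close>

definition wt_sub :: "(oconst \<times> arity) set \<Rightarrow> nat \<Rightarrow> subst \<Rightarrow> (var \<times> arity) set \<Rightarrow> (var \<times> arity) set \<Rightarrow> bool" where
  "wt_sub S n \<theta> \<Theta> \<Theta>' \<longleftrightarrow> finite \<theta> \<and> finite \<Theta> \<and> finite \<Theta>' \<and>
    (\<forall>(x, \<beta>) \<in> \<Theta>. (\<exists>M. (x, M, \<beta>) \<in> \<theta> \<and> wt_tm S \<Theta>' [] M \<beta> \<and> size \<beta> < n)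
      \<or> (x \<notin> sdom \<theta> \<and> (x, \<beta>) \<in> \<Theta>'))"

lemma wt_sub_insert:
  assumes "wt_sub S n \<theta> \<Theta> \<Theta>'" "x \<notin> sdom \<theta>"
  shows "wt_sub S n \<theta> (insert (x, \<beta>) \<Theta>) (insert (x, \<beta>) \<Theta>')"
  using assms wt_mono_tm[of S \<Theta>' "[]" _ _ S "insert (x, \<beta>) \<Theta>'"]
  unfolding wt_sub_def by fastforce

lemma wt_sub_single:
  assumes "finite \<Theta>" "x \<notin> fst ` \<Theta>" "wt_tm S \<Theta> [] M \<beta>" "size \<beta> < n"
  shows "wt_sub S n {(x, M, \<beta>)} (insert (x, \<beta>) \<Theta>) \<Theta>"
  using assms by (force simp: wt_sub_def sdom_def)

lemma finite_fv_tm: "finite (fv_tm M)" and finite_fv_atm: "finite (fv_atm R)"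
  by (induction M and R) auto

lemma finite_not_fresh: "finite \<theta> \<Longrightarrow> finite {x. \<not> fresh_for x \<theta>}"
proof -
  assume "finite \<theta>"
  then have "finite (\<Union>(x, M, \<alpha>)\<in>\<theta>. insert x (fv_tm M))" by (auto simp: finite_fv_tm)
  moreover have "{x. \<not> fresh_for x \<theta>} \<subseteq> (\<Union>(x, M, \<alpha>)\<in>\<theta>. insert x (fv_tm M))"
    by (fastforce simp: fresh_for_def sdom_def)
  ultimately show ?thesis by (rule finite_subset[rotated])
qed

text \<open>Lexicographic induction on the bound \<open>n\<close> and the size of the expression.
  Substituting into a subexpression keeps \<open>n\<close>; the substitution created by a head
  reduction may enter a larger term, but at a smaller arity. The clause
  \<open>size \<alpha> < n\<close> records that a reduced head takes its arity from a substituted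
  variable. Both sorts share one size \<open>k\<close>, so a single induction covers them.\<close>

lemma hsub_total_aux:
  assumes "wt_sub S n \<theta> \<Theta> \<Theta>'"
  shows "(size M = k \<longrightarrow> wt_tm S \<Theta> [] M \<alpha> \<longrightarrow> (\<exists>M' h. hsub_tm_h h \<theta> M M' \<and> wt_tm S \<Theta>' [] M' \<alpha>)) \<and>
    (size R = k \<longrightarrow> wt_atm S \<Theta> [] R \<alpha> \<longrightarrow> (\<exists>R' h. hsub_atm_h h \<theta> R R' \<and> wt_atm S \<Theta>' [] R' \<alpha>) \<or>
      (\<exists>M' h. hsub_red_h h \<theta> R M' \<alpha> \<and> wt_tm S \<Theta>' [] M' \<alpha> \<and> size \<alpha> < n))"
  using assms
proof (induction n arbitrary: k M R \<theta> \<Theta> \<Theta>' \<alpha> rule: less_induct)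
  case (less n)
  note outer = less.IH
  from less.prems show ?case
  proof (induction k arbitrary: M R \<Theta> \<Theta>' \<alpha> rule: less_induct)
    case (less k)
    note sub = \<open>wt_sub S n \<theta> \<Theta> \<Theta>'\<close>
    have IHtm: "\<exists>M' h. hsub_tm_h h \<theta> N M' \<and> wt_tm S \<Theta>2 [] M' \<beta>"
      if "size N < k" "wt_sub S n \<theta> \<Theta>1 \<Theta>2" "wt_tm S \<Theta>1 [] N \<beta>" for N \<beta> \<Theta>1 \<Theta>2
      using less.IH[OF that(1,2)] that(3) by blast
    have IHatm: "(\<exists>R' h. hsub_atm_h h \<theta> Q R' \<and> wt_atm S \<Theta>' [] R' \<beta>) \<or>
      (\<exists>M' h. hsub_red_h h \<theta> Q M' \<beta> \<and> wt_tm S \<Theta>' [] M' \<beta> \<and> size \<beta> < n)"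
      if "size Q < k" "wt_atm S \<Theta> [] Q \<beta>" for Q \<beta>
      using less.IH[OF that(1) sub] that(2) by blast
    have fin: "finite \<theta>" "finite \<Theta>" "finite \<Theta>'" using sub by (auto simp: wt_sub_def)
    have tm: "\<exists>M' h. hsub_tm_h h \<theta> M M' \<and> wt_tm S \<Theta>' [] M' \<alpha>" if "size M = k" "wt_tm S \<Theta> [] M \<alpha>"
    proof (cases M)
      case (Atm R)
      with that have "\<alpha> = Obj" "wt_atm S \<Theta> [] R Obj" "size R < k" by auto
      with IHatm[of R Obj] Atm show ?thesis
        by simp (metis tm_atm tm_red wt_tm.simps(1))
    next
      case (LamB M0)
      with that obtain \<beta> \<gamma> where \<alpha>: "\<alpha> = Arr \<beta> \<gamma>" by auto
      obtain x N where x: "x \<notin> {x. \<not> fresh_for x \<theta>} \<union> fst ` \<Theta> \<union> fst ` \<Theta>'" and M: "M = lam x N"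
        using fresh_lam[of "{x. \<not> fresh_for x \<theta>} \<union> fst ` \<Theta> \<union> fst ` \<Theta>'" M0] fin finite_not_fresh LamB by auto
      have "size N < k" using that M by (auto simp: lam_def)
      moreover have "wt_tm S (insert (x, \<beta>) \<Theta>) [] N \<gamma>" using that M \<alpha> by (auto dest: wt_lamD)
      moreover have "wt_sub S n \<theta> (insert (x, \<beta>) \<Theta>) (insert (x, \<beta>) \<Theta>')"
        using sub x by (auto intro!: wt_sub_insert simp: fresh_for_def)
      ultimately obtain N' h where "hsub_tm_h h \<theta> N N'" "wt_tm S (insert (x, \<beta>) \<Theta>') [] N' \<gamma>"
        using IHtm by blast
      with x M \<alpha> show ?thesis by (auto intro: tm_lam wt_lam)
    qed
    have "(\<exists>R' h. hsub_atm_h h \<theta> R R' \<and> wt_atm S \<Theta>' [] R' \<alpha>) \<or>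
      (\<exists>M' h. hsub_red_h h \<theta> R M' \<alpha> \<and> wt_tm S \<Theta>' [] M' \<alpha> \<and> size \<alpha> < n)"
      if R: "size R = k" "wt_atm S \<Theta> [] R \<alpha>"
    proof (cases R)
      case (Const c)
      with that show ?thesis by (metis atm_const wt_atm.simps(1))
    next
      case (FVar x)
      with that sub have "(\<exists>M. (x, M, \<alpha>) \<in> \<theta> \<and> wt_tm S \<Theta>' [] M \<alpha> \<and> size \<alpha> < n)
        \<or> (x \<notin> sdom \<theta> \<and> (x, \<alpha>) \<in> \<Theta>')" by (auto simp: wt_sub_def)
      with FVar show ?thesis by (metis atm_var red_var wt_atm.simps(2))
    next
      case (BVar i)
      with that show ?thesis by simp
    next
      case (App Q N)
      with that obtain \<beta> where wt: "wt_atm S \<Theta> [] Q (Arr \<beta> \<alpha>)" "wt_tm S \<Theta> [] N \<beta>" by auto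
      obtain N' h2 where N': "hsub_tm_h h2 \<theta> N N'" "wt_tm S \<Theta>' [] N' \<beta>"
        using IHtm[of N, OF _ sub wt(2)] R App by auto
      from IHatm[of Q "Arr \<beta> \<alpha>"] wt R App consider
        (a) R' h where "hsub_atm_h h \<theta> Q R'" "wt_atm S \<Theta>' [] R' (Arr \<beta> \<alpha>)"
        | (b) M1 h where "hsub_red_h h \<theta> Q M1 (Arr \<beta> \<alpha>)" "wt_tm S \<Theta>' [] M1 (Arr \<beta> \<alpha>)" "size (Arr \<beta> \<alpha>) < n"
        by auto
      then show ?thesis
      proof cases
        case a
        then have "hsub_atm_h (Suc (max h h2)) \<theta> R (App R' N')" "wt_atm S \<Theta>' [] (App R' N') \<alpha>"
          using App N' by (auto intro: atm_app)
        then show ?thesis by blast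
      next
        case b
        \<comment> \<open>Eta-long form: at an arrow arity the reduct can only be an
          abstraction.\<close>
        then obtain M0 where "M1 = LamB M0" by (cases M1) auto
        then obtain x M' where x: "x \<notin> fst ` \<Theta>'" and M1: "M1 = lam x M'"
          using fresh_lam[of "fst ` \<Theta>'" M0] fin by auto
        have "wt_tm S (insert (x, \<beta>) \<Theta>') [] M' \<alpha>" using b(2) M1 wt_lamD by blast
        \<comment> \<open>The argument has arity \<beta>, smaller than the arrow, and the arrow is
          below \<open>n\<close>: the size of the arrow is the bound for the outer
          induction.\<close>
        moreover have "wt_sub S (size (Arr \<beta> \<alpha>)) {(x, N', \<beta>)} (insert (x, \<beta>) \<Theta>') \<Theta>'"
          using fin x N'(2) by (intro wt_sub_single) auto
        ultimately obtain M'' h3 where "hsub_tm_h h3 {(x, N', \<beta>)} M' M''" "wt_tm S \<Theta>' [] M'' \<alpha>"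
          using outer[OF b(3)] by blast
        moreover from this N' b(1) M1 App have "hsub_red_h (Suc (max h (max h2 h3))) \<theta> R M'' \<alpha>"
          by (auto intro: red_app)
        ultimately show ?thesis using b(3) by auto
      qed
    qed
    with tm show ?case by blast
  qed
qed

lemma hsub_total_tm:
  "wt_sub S n \<theta> \<Theta> \<Theta>' \<Longrightarrow> wt_tm S \<Theta> [] M \<alpha> \<Longrightarrow> \<exists>M' h. hsub_tm_h h \<theta> M M' \<and> wt_tm S \<Theta>' [] M' \<alpha>"
  using hsub_total_aux by blast

lemma hsub_total_aty:
  "wt_sub S n \<theta> \<Theta> \<Theta>' \<Longrightarrow> wt_aty S \<Theta> [] P \<Longrightarrow> \<exists>P' h. hsub_aty_h h \<theta> P P' \<and> wt_aty S \<Theta>' [] P'"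
proof (induction P)
  case (TConst a)
  then show ?case by (metis aty_const wt_aty.simps(1))
next
  case (TApp P M)
  then show ?case using hsub_total_tm[OF TApp.prems(1), of M] by simp (metis aty_app wt_aty.simps(2))
qed

lemma hsub_erase: "hsub_ty_h h \<theta> A A' \<Longrightarrow> erase A' = erase A"
  by (induction rule: hsub_ty_h.induct) (auto simp: pi_def)

lemma hsub_total_ty:
  "wt_sub S n \<theta> \<Theta> \<Theta>' \<Longrightarrow> wt_ty S \<Theta> [] A \<Longrightarrow> \<exists>A'. hsub_ty \<theta> A A' \<and> wt_ty S \<Theta>' [] A'"
proof (induction "size A" arbitrary: A \<Theta> \<Theta>' rule: less_induct)
  case less
  show ?case
  proof (cases A)
    case (Base P)
    with less.prems hsub_total_aty[of S n \<theta> \<Theta> \<Theta>' P] show ?thesis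
      unfolding hsub_ty_def by simp (metis ty_base wt_ty.simps(1))
  next
    case (PiB A1 B)
    let ?X = "{x. \<not> fresh_for x \<theta>} \<union> fst ` \<Theta> \<union> fst ` \<Theta>'"
    have "finite ?X" using less.prems finite_not_fresh by (auto simp: wt_sub_def)
    then obtain x A2 where x: "x \<notin> ?X" and A: "A = pi x A1 A2"
      using fresh_pi[of ?X A1 B] PiB by auto
    have wt: "wt_ty S \<Theta> [] A1" "wt_ty S (insert (x, erase A1) \<Theta>) [] A2"
      using less.prems(2) A by (auto dest: wt_piD)
    have "size A1 < size A" "size A2 < size A" by (auto simp: A pi_def)
    with less wt obtain A1' where A1': "hsub_ty \<theta> A1 A1'" "wt_ty S \<Theta>' [] A1'" by blast
    have "wt_sub S n \<theta> (insert (x, erase A1) \<Theta>) (insert (x, erase A1) \<Theta>')"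
      using less.prems(1) x by (auto intro!: wt_sub_insert simp: fresh_for_def)
    with less.hyps[OF \<open>size A2 < size A\<close>] wt(2) obtain A2'
      where A2': "hsub_ty \<theta> A2 A2'" "wt_ty S (insert (x, erase A1) \<Theta>') [] A2'" by blast
    have "erase A1' = erase A1" using A1'(1) hsub_erase unfolding hsub_ty_def by blast
    then have "wt_ty S \<Theta>' [] (pi x A1' A2')" using x A1' A2' by (auto intro: wt_pi)
    moreover have "hsub_ty \<theta> A (pi x A1' A2')"
      using x A1' A2' A unfolding hsub_ty_def by (auto intro: ty_pi)
    ultimately show ?thesis by blast
  qed
qed

lemma hsub_total_kd:
  "wt_sub S n \<theta> \<Theta> \<Theta>' \<Longrightarrow> wt_kd S \<Theta> [] K \<Longrightarrow> \<exists>K' h. hsub_kd_h h \<theta> K K' \<and> wt_kd S \<Theta>' [] K'"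
proof (induction "size K" arbitrary: K \<Theta> \<Theta>' rule: less_induct)
  case less
  show ?case
  proof (cases K)
    case Type
    then show ?thesis by (metis kd_type wt_kd.simps(1))
  next
    case (KPiB A1 B)
    let ?X = "{x. \<not> fresh_for x \<theta>} \<union> fst ` \<Theta> \<union> fst ` \<Theta>'"
    have "finite ?X" using less.prems finite_not_fresh by (auto simp: wt_sub_def)
    then obtain x K2 where x: "x \<notin> ?X" and K: "K = kpi x A1 K2"
      using fresh_kpi[of ?X A1 B] KPiB by auto
    have wt: "wt_ty S \<Theta> [] A1" "wt_kd S (insert (x, erase A1) \<Theta>) [] K2"
      using less.prems(2) K by (auto dest: wt_kpiD)
    have "size K2 < size K" by (auto simp: K kpi_def)
    obtain A1' h1 where A1': "hsub_ty_h h1 \<theta> A1 A1'" "wt_ty S \<Theta>' [] A1'"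
      using hsub_total_ty[OF less.prems(1) wt(1)] unfolding hsub_ty_def by blast
    have "wt_sub S n \<theta> (insert (x, erase A1) \<Theta>) (insert (x, erase A1) \<Theta>')"
      using less.prems(1) x by (auto intro!: wt_sub_insert simp: fresh_for_def)
    with less.hyps[OF \<open>size K2 < size K\<close>] wt(2) obtain K2' h2
      where K2': "hsub_kd_h h2 \<theta> K2 K2'" "wt_kd S (insert (x, erase A1) \<Theta>') [] K2'" by blast
    have "wt_kd S \<Theta>' [] (kpi x A1' K2')" using x A1' K2' hsub_erase[OF A1'(1)] by (auto intro: wt_kpi)
    moreover have "hsub_kd_h (Suc (max h1 h2)) \<theta> K (kpi x A1' K2')"
      using x A1' K2' K by (auto intro: kd_pi)
    ultimately show ?thesis by blast
  qed
qed

text \<open>Supplies the substitution premise of the application rule. The binder name is chosen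
  here, whereas the reduction describes the result without naming a binder, so results obtained
  under different names can be compared.\<close>

lemma inst_total_ty:
  assumes "finite X" "finite \<Theta>" "wt_ty S \<Theta> [] (PiB A B)" "wt_tm S \<Theta> [] M (erase A)"
  shows "\<exists>x A2 A'. x \<notin> X \<and> PiB A B = pi x A A2 \<and> hsub_ty {(x, M, erase A)} A2 A'
    \<and> red (inst (emb_ty B) (emb_tm M)) (emb_ty A') \<and> wt_ty S \<Theta> [] A'"
proof -
  obtain x A2 where x: "x \<notin> X \<union> fst ` \<Theta>" "PiB A B = pi x A A2"
    using fresh_pi[of "X \<union> fst ` \<Theta>" A B] assms(1,2) by blast
  then have "wt_ty S (insert (x, erase A) \<Theta>) [] A2" using assms(3) by (auto dest: wt_piD)
  with wt_sub_single[of \<Theta> x S M "erase A"] x assms obtain A'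
    where A': "hsub_ty {(x, M, erase A)} A2 A'" "wt_ty S \<Theta> [] A'"
    using hsub_total_ty by blast
  have B: "emb_ty B = ren (absr x) (emb_ty A2)" using x(2) by (simp add: pi_def emb_abs_ty)
  have "red (inst (emb_ty B) (emb_tm M)) (emb_ty A')"
    unfolding B inst_absr using A'(1) hsub_sound_ty agrees_single unfolding hsub_ty_def by blast
  with x A' show ?thesis by blast
qed

lemma inst_total_kd:
  assumes "finite X" "finite \<Theta>" "wt_kd S \<Theta> [] (KPiB A B)" "wt_tm S \<Theta> [] M (erase A)"
  shows "\<exists>x K2 K' h. x \<notin> X \<and> KPiB A B = kpi x A K2 \<and> hsub_kd_h h {(x, M, erase A)} K2 K'
    \<and> red (inst (emb_kd B) (emb_tm M)) (emb_kd K') \<and> wt_kd S \<Theta> [] K'"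
proof -
  obtain x A2 where x: "x \<notin> X \<union> fst ` \<Theta>" "KPiB A B = kpi x A A2"
    using fresh_kpi[of "X \<union> fst ` \<Theta>" A B] assms(1,2) by blast
  then have "wt_kd S (insert (x, erase A) \<Theta>) [] A2" using assms(3) by (auto dest: wt_kpiD)
  with wt_sub_single[of \<Theta> x S M "erase A"] x assms obtain A' h
    where A': "hsub_kd_h h {(x, M, erase A)} A2 A'" "wt_kd S \<Theta> [] A'"
    using hsub_total_kd by blast
  have B: "emb_kd B = ren (absr x) (emb_kd A2)" using x(2) by (simp add: kpi_def emb_abs_kd)
  have "red (inst (emb_kd B) (emb_tm M)) (emb_kd A')"
    unfolding B inst_absr using A'(1) hsub_sound_kd agrees_single by blast
  with x A' show ?thesis by blast
qed

section \<open>From LF typing to arity typing\<close>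

definition ar :: "ctx \<Rightarrow> (var \<times> arity) set" where
  "ar \<Gamma> = (\<lambda>(x, A). (x, erase A)) ` set \<Gamma>"

definition sg :: "sig \<Rightarrow> (oconst \<times> arity) set" where
  "sg \<Sigma> = {(c, erase A) | c A. ODecl c A \<in> set \<Sigma>}"

text \<open>Declarations are judged in the whole signature and not only in what precedes them, which
  suits a lookup. Monotonicity of arity typing derives this from well-formedness. Contexts are
  treated alike below.\<close>

definition wt_sig :: "sig \<Rightarrow> bool" where
  "wt_sig \<Sigma> \<longleftrightarrow> (\<forall>c A. ODecl c A \<in> set \<Sigma> \<longrightarrow> wt_ty (sg \<Sigma>) {} [] A)
    \<and> (\<forall>a K. TDecl a K \<in> set \<Sigma> \<longrightarrow> wt_kd (sg \<Sigma>) {} [] K)"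

definition wt_ctx :: "sig \<Rightarrow> ctx \<Rightarrow> bool" where
  "wt_ctx \<Sigma> \<Gamma> \<longleftrightarrow> (\<forall>(x, A) \<in> set \<Gamma>. wt_ty (sg \<Sigma>) (ar \<Gamma>) [] A)"

lemma ar_simps [simp]: "ar [] = {}" "ar ((x, A) # \<Gamma>) = insert (x, erase A) (ar \<Gamma>)"
  "ar (\<Gamma> @ \<Gamma>') = ar \<Gamma> \<union> ar \<Gamma>'"
  by (auto simp: ar_def)

lemma fst_ar [simp]: "fst ` ar \<Gamma> = fst ` set \<Gamma>"
  by (force simp: ar_def)

lemma finite_ar [simp]: "finite (ar \<Gamma>)"
  by (simp add: ar_def)

lemma wt_ctx_Cons: "wt_ctx \<Sigma> \<Gamma> \<Longrightarrow> wt_ty (sg \<Sigma>) (ar \<Gamma>) [] A \<Longrightarrow> wt_ctx \<Sigma> ((x, A) # \<Gamma>)"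
  by (auto simp: wt_ctx_def elim!: wt_mono_ty)

lemma inst_sound_ty:
  "hsub_ty_h h {(x, M, \<alpha>)} A2 A \<Longrightarrow> PiB A1 B = pi x A1 A2 \<Longrightarrow> red (inst (emb_ty B) (emb_tm M)) (emb_ty A)"
  using hsub_sound_ty[OF _ agrees_single] by (simp add: pi_def emb_abs_ty inst_absr)

lemma inst_sound_kd:
  "hsub_kd_h h {(x, M, \<alpha>)} K2 K \<Longrightarrow> KPiB A1 B = kpi x A1 K2 \<Longrightarrow> red (inst (emb_kd B) (emb_tm M)) (emb_kd K)"
  using hsub_sound_kd[OF _ agrees_single] by (simp add: kpi_def emb_abs_kd inst_absr)

text \<open>Synthesis delivers an arity-typed type whereas checking is given one, hence the extra
  hypothesis for \<open>check_h\<close>.\<close>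

lemma kind_wt: "kind_h \<Sigma> h \<Gamma> K \<Longrightarrow> wt_sig \<Sigma> \<Longrightarrow> wt_ctx \<Sigma> \<Gamma> \<Longrightarrow> wt_kd (sg \<Sigma>) (ar \<Gamma>) [] K"
  and type_wt: "type_h \<Sigma> h \<Gamma> A \<Longrightarrow> wt_sig \<Sigma> \<Longrightarrow> wt_ctx \<Sigma> \<Gamma> \<Longrightarrow> wt_ty (sg \<Sigma>) (ar \<Gamma>) [] A"
  and synth_aty_wt: "synth_aty_h \<Sigma> h \<Gamma> P K \<Longrightarrow> wt_sig \<Sigma> \<Longrightarrow> wt_ctx \<Sigma> \<Gamma> \<Longrightarrow>
    wt_aty (sg \<Sigma>) (ar \<Gamma>) [] P \<and> wt_kd (sg \<Sigma>) (ar \<Gamma>) [] K"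
  and synth_wt: "synth_h \<Sigma> h \<Gamma> R A \<Longrightarrow> wt_sig \<Sigma> \<Longrightarrow> wt_ctx \<Sigma> \<Gamma> \<Longrightarrow>
    wt_atm (sg \<Sigma>) (ar \<Gamma>) [] R (erase A) \<and> wt_ty (sg \<Sigma>) (ar \<Gamma>) [] A"
  and check_wt: "check_h \<Sigma> h \<Gamma> M A \<Longrightarrow> wt_sig \<Sigma> \<Longrightarrow> wt_ctx \<Sigma> \<Gamma> \<Longrightarrow> wt_ty (sg \<Sigma>) (ar \<Gamma>) [] A \<Longrightarrow>
    wt_tm (sg \<Sigma>) (ar \<Gamma>) [] M (erase A)"
proof (induction rule: kind_h_type_h_synth_aty_h_synth_h_check_h.inducts)
  case (kind_pi x \<Gamma> h1 A h2 K)
  then show ?case using wt_kpi[of x "ar \<Gamma>"] by (simp add: wt_ctx_Cons)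
next
  case (type_pi x \<Gamma> h1 A1 h2 A2)
  then show ?case using wt_pi[of x "ar \<Gamma>"] by (simp add: wt_ctx_Cons)
next
  case (synth_tconst a K \<Gamma>)
  then show ?case by (auto simp: wt_sig_def elim!: wt_mono_kd)
next
  case (synth_tapp h1 \<Gamma> P x A K1 h2 M h3 K)
  obtain B where B: "KPiB A B = kpi x A K1" by (simp add: kpi_def)
  with synth_tapp have K: "wt_kd (sg \<Sigma>) (ar \<Gamma>) [] (KPiB A B)" by auto
  then have M: "wt_tm (sg \<Sigma>) (ar \<Gamma>) [] M (erase A)" using synth_tapp by auto
  \<comment> \<open>The name \<open>x\<close> in the rule need not be fresh for \<Gamma>, so
    totality does not speak about its premise directly. Totality under a fresh name gives some
    \<open>K'\<close>, and both kinds are normal forms of the same instance.\<close>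
  obtain K' where "red (inst (emb_kd B) (emb_tm M)) (emb_kd K')" "wt_kd (sg \<Sigma>) (ar \<Gamma>) [] K'"
    using inst_total_kd[OF finite.emptyI _ K M] by auto
  moreover from inst_sound_kd[OF synth_tapp.hyps(1) B]
  have "red (inst (emb_kd B) (emb_tm M)) (emb_kd K)" .
  ultimately have "wt_kd (sg \<Sigma>) (ar \<Gamma>) [] K" using red_emb_kd_unique by blast
  then show ?case using synth_tapp M by auto
next
  case (check_lam x \<Gamma> h A1 M A2)
  then have "wt_ty (sg \<Sigma>) (ar \<Gamma>) [] A1" "wt_ty (sg \<Sigma>) (ar ((x, A1) # \<Gamma>)) [] A2" by (auto dest: wt_piD)
  then have "wt_tm (sg \<Sigma>) (ar ((x, A1) # \<Gamma>)) [] M (erase A2)"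
    using check_lam by (auto intro: wt_ctx_Cons)
  then show ?case using check_lam.hyps wt_lam[of x "ar \<Gamma>"] by (simp add: pi_def)
next
  case (synth_var x A \<Gamma>)
  then show ?case by (force simp: wt_ctx_def ar_def)
next
  case (synth_const c A \<Gamma>)
  then show ?case by (auto simp: wt_sig_def sg_def elim!: wt_mono_ty)
next
  case (synth_app h1 \<Gamma> R x A1 A2 h2 M h3 A)
  obtain B where B: "PiB A1 B = pi x A1 A2" by (simp add: pi_def)
  with synth_app have T: "wt_ty (sg \<Sigma>) (ar \<Gamma>) [] (PiB A1 B)" by auto
  then have M: "wt_tm (sg \<Sigma>) (ar \<Gamma>) [] M (erase A1)" using synth_app by auto
  obtain A' where "red (inst (emb_ty B) (emb_tm M)) (emb_ty A')" "wt_ty (sg \<Sigma>) (ar \<Gamma>) [] A'"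
    using inst_total_ty[OF finite.emptyI _ T M] by auto
  moreover from inst_sound_ty[OF synth_app.hyps(1) B]
  have "red (inst (emb_ty B) (emb_tm M)) (emb_ty A)" .
  ultimately have "wt_ty (sg \<Sigma>) (ar \<Gamma>) [] A" using red_emb_ty_unique by blast
  then show ?case using synth_app M hsub_erase[OF synth_app.hyps(1)] by (auto simp: pi_def)
qed auto

section \<open>The substitution theorem\<close>

definition synth_aty :: "sig \<Rightarrow> ctx \<Rightarrow> aty \<Rightarrow> kd \<Rightarrow> bool" where
  "synth_aty \<Sigma> \<Gamma> P K \<longleftrightarrow> (\<exists>h. synth_aty_h \<Sigma> h \<Gamma> P K)"

lemma is_type_pi: "x \<notin> fst ` set \<Gamma> \<Longrightarrow> is_type \<Sigma> \<Gamma> A1 \<Longrightarrow> is_type \<Sigma> ((x, A1) # \<Gamma>) A2 \<Longrightarrow> is_type \<Sigma> \<Gamma> (pi x A1 A2)"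
  unfolding is_type_def by (auto intro: type_pi)

lemma check_lamI: "x \<notin> fst ` set \<Gamma> \<Longrightarrow> check \<Sigma> ((x, A1) # \<Gamma>) M A2 \<Longrightarrow> check \<Sigma> \<Gamma> (lam x M) (pi x A1 A2)"
  unfolding check_def by (auto intro: check_lam)

lemma check_is_wt: "check \<Sigma> \<Gamma> M A \<Longrightarrow> wt_sig \<Sigma> \<Longrightarrow> wt_ctx \<Sigma> \<Gamma> \<Longrightarrow> wt_ty (sg \<Sigma>) (ar \<Gamma>) [] A \<Longrightarrow>
    wt_tm (sg \<Sigma>) (ar \<Gamma>) [] M (erase A)"
  unfolding check_def using check_wt by blast

lemma synth_is_wt: "synth \<Sigma> \<Gamma> R A \<Longrightarrow> wt_sig \<Sigma> \<Longrightarrow> wt_ctx \<Sigma> \<Gamma> \<Longrightarrow> wt_ty (sg \<Sigma>) (ar \<Gamma>) [] A"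
  unfolding synth_def using synth_wt by blast

text \<open>The substitution premise comes for free, since well-typed expressions are arity-typed;
  the reduction pins down the synthesized type.\<close>

lemma synth_app_ex:
  assumes "wt_sig \<Sigma>" "wt_ctx \<Sigma> \<Gamma>" "synth \<Sigma> \<Gamma> R (PiB A B)" "check \<Sigma> \<Gamma> M A"
  shows "\<exists>A'. red (inst (emb_ty B) (emb_tm M)) (emb_ty A') \<and> synth \<Sigma> \<Gamma> (App R M) A' \<and> wt_ty (sg \<Sigma>) (ar \<Gamma>) [] A'"
proof -
  have T: "wt_ty (sg \<Sigma>) (ar \<Gamma>) [] (PiB A B)" using synth_is_wt assms by blast
  then have M: "wt_tm (sg \<Sigma>) (ar \<Gamma>) [] M (erase A)" using check_is_wt assms by auto
  show ?thesis using inst_total_ty[OF finite.emptyI _ T M] assms(3,4)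
    unfolding synth_def check_def hsub_ty_def by simp (metis synth_app)
qed

lemma synth_tapp_ex:
  assumes "wt_sig \<Sigma>" "wt_ctx \<Sigma> \<Gamma>" "synth_aty \<Sigma> \<Gamma> P (KPiB A B)" "check \<Sigma> \<Gamma> M A"
  shows "\<exists>K'. red (inst (emb_kd B) (emb_tm M)) (emb_kd K') \<and> synth_aty \<Sigma> \<Gamma> (TApp P M) K'"
proof -
  have T: "wt_kd (sg \<Sigma>) (ar \<Gamma>) [] (KPiB A B)" using synth_aty_wt assms unfolding synth_aty_def by blast
  then have M: "wt_tm (sg \<Sigma>) (ar \<Gamma>) [] M (erase A)" using check_is_wt assms by auto
  show ?thesis using inst_total_kd[OF finite.emptyI _ T M] assms(3,4)
    unfolding synth_aty_def check_def by simp (metis synth_tapp)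
qed

section \<open>Reducts of substituted types and kinds\<close>

lemma red_pi:
  assumes "red (Ap (Ap (Cst c) t) (Ab u)) s"
  shows "\<exists>t' u'. s = Ap (Ap (Cst c) t') (Ab u') \<and> red t t' \<and> red u u'"
  using assms
proof (induction rule: rtranclp_induct)
  case (step y z)
  then obtain t' u' where y: "y = Ap (Ap (Cst c) t') (Ab u')" "red t t'" "red u u'" by blast
  with step.hyps(2) obtain t'' u'' where "z = Ap (Ap (Cst c) t'') (Ab u'')" "par t' t''" "par u' u''"
    by (auto elim!: par_ApE par_AbE par_CstE)
  with y show ?case by (blast intro: rtranclp.rtrancl_into_rtrancl)
qed auto

lemma red_sub_PiB:
  assumes "red (sub \<sigma> (emb_ty (PiB A B))) (emb_ty T)"
  shows "\<exists>A' B'. T = PiB A' B' \<and> red (sub \<sigma> (emb_ty A)) (emb_ty A') \<and> red (sub (up \<sigma>) (emb_ty B)) (emb_ty B')"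
  using assms red_pi[of CPi "sub \<sigma> (emb_ty A)" "sub (up \<sigma>) (emb_ty B)" "emb_ty T"] by (cases T) auto

lemma red_sub_KPiB:
  assumes "red (sub \<sigma> (emb_kd (KPiB A B))) (emb_kd T)"
  shows "\<exists>A' B'. T = KPiB A' B' \<and> red (sub \<sigma> (emb_ty A)) (emb_ty A') \<and> red (sub (up \<sigma>) (emb_kd B)) (emb_kd B')"
  using assms red_pi[of CKPi "sub \<sigma> (emb_ty A)" "sub (up \<sigma>) (emb_kd B)" "emb_kd T"] by (cases T) auto

text \<open>Separates atomic types from products even after substitution and reduction: a type
  constant at the head is never substituted, and no redex can form along the path to it.\<close>

fun ty_head :: "lt \<Rightarrow> bool" where
  "ty_head (Cst (CTy a)) = True"
| "ty_head (Ap t u) = ty_head t"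
| "ty_head _ = False"

lemma par_ty_head: "par t u \<Longrightarrow> ty_head t \<Longrightarrow> ty_head u"
  by (induction rule: par.induct) auto

lemma red_sub_Base: "red (sub \<sigma> (emb_ty (Base P))) (emb_ty T) \<Longrightarrow> \<exists>P'. T = Base P'"
proof -
  assume red: "red (sub \<sigma> (emb_ty (Base P))) (emb_ty T)"
  have "ty_head (sub \<sigma> (emb_aty P))" by (induction P) auto
  with red have "ty_head (emb_ty T)"
    by (simp, induction rule: rtranclp_induct) (auto dest: par_ty_head)
  then show ?thesis by (cases T) auto
qed

lemma red_erase: "red (sub \<sigma> (emb_ty A)) (emb_ty A') \<Longrightarrow> erase A' = erase A"
proof (induction A arbitrary: \<sigma> A')
  case (Base P)
  then show ?case using red_sub_Base[of \<sigma> P A'] by auto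
next
  case (PiB A B)
  then show ?case using red_sub_PiB[OF PiB.prems] by auto
qed

text \<open>
  The bound \<open>n\<close> on the arities of the substituted terms drives the induction. For \<open>n = 0\<close> only
  variables are substituted, so that weakening is the base case of the substitution theorem.
\<close>

definition ctx_map :: "sig \<Rightarrow> nat \<Rightarrow> (vr \<Rightarrow> lt) \<Rightarrow> ctx \<Rightarrow> ctx \<Rightarrow> bool" where
  "ctx_map \<Sigma> n \<sigma> \<Gamma> \<Gamma>' \<longleftrightarrow> wt_ctx \<Sigma> \<Gamma> \<and> wt_ctx \<Sigma> \<Gamma>' \<and> (\<forall>i. \<sigma> (Ix i) = Vr (Ix i)) \<and>
    (\<forall>(x, A) \<in> set \<Gamma>. \<exists>A'. red (sub \<sigma> (emb_ty A)) (emb_ty A') \<and>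
      ((\<exists>y. \<sigma> (Nm x) = Vr (Nm y) \<and> (y, A') \<in> set \<Gamma>') \<or>
       (\<exists>M. \<sigma> (Nm x) = emb_tm M \<and> check \<Sigma> \<Gamma>' M A' \<and> wt_ty (sg \<Sigma>) (ar \<Gamma>') [] A' \<and> size (erase A) < n)))"

text \<open>The checking part of the substitution theorem as a predicate of the bound. The proof for
  \<open>n\<close> calls it at 0, for weakening under binders, and at smaller bounds, for the
  contractions caused by head reduction.\<close>

definition sub_check :: "sig \<Rightarrow> nat \<Rightarrow> bool" where
  "sub_check \<Sigma> n \<longleftrightarrow> (\<forall>h \<Gamma> M A \<sigma> \<Gamma>' A'. check_h \<Sigma> h \<Gamma> M A \<longrightarrow> ctx_map \<Sigma> n \<sigma> \<Gamma> \<Gamma>' \<longrightarrow>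
    wt_ty (sg \<Sigma>) (ar \<Gamma>) [] A \<longrightarrow> red (sub \<sigma> (emb_ty A)) (emb_ty A') \<longrightarrow> wt_ty (sg \<Sigma>) (ar \<Gamma>') [] A' \<longrightarrow>
    (\<exists>M'. red (sub \<sigma> (emb_tm M)) (emb_tm M') \<and> check \<Sigma> \<Gamma>' M' A'))"

lemma ctx_map_weaken: "wt_ctx \<Sigma> \<Gamma> \<Longrightarrow> wt_ctx \<Sigma> \<Gamma>' \<Longrightarrow> set \<Gamma> \<subseteq> set \<Gamma>' \<Longrightarrow> ctx_map \<Sigma> n Vr \<Gamma> \<Gamma>'"
  by (auto simp: ctx_map_def)

lemma ar_mono: "set \<Gamma> \<subseteq> set \<Gamma>' \<Longrightarrow> ar \<Gamma> \<subseteq> ar \<Gamma>'"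
  by (auto simp: ar_def)

lemma weaken_check:
  assumes "sub_check \<Sigma> 0" "wt_ctx \<Sigma> \<Gamma>" "wt_ctx \<Sigma> \<Gamma>'" "set \<Gamma> \<subseteq> set \<Gamma>'" "check \<Sigma> \<Gamma> M A"
    "wt_ty (sg \<Sigma>) (ar \<Gamma>) [] A"
  shows "check \<Sigma> \<Gamma>' M A"
proof -
  have "wt_ty (sg \<Sigma>) (ar \<Gamma>') [] A" using wt_mono_ty[OF assms(6) subset_refl ar_mono] assms by blast
  with assms obtain M' where "red (sub Vr (emb_tm M)) (emb_tm M')" "check \<Sigma> \<Gamma>' M' A"
    using ctx_map_weaken[OF assms(2-4)] unfolding sub_check_def check_def[of \<Sigma> \<Gamma>]
    by (metis rtranclp.rtrancl_refl sub_Vr)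
  then show ?thesis using red_emb_tm_unique[of "emb_tm M" M M'] by simp
qed

lemma wt_fresh_ty:
  assumes "wt_ty S (ar \<Gamma>) [] A" "x \<notin> fst ` set \<Gamma>"
  shows "sub (\<sigma>(Nm x := t)) (emb_ty A) = sub \<sigma> (emb_ty A)"
proof (rule sub_cong_fv)
  fix v assume "v \<in> fv (emb_ty A)"
  with wt_fv_ty[OF assms(1)] have "v \<in> Nm ` fst ` set \<Gamma>" by auto
  with assms(2) show "(\<sigma>(Nm x := t)) v = \<sigma> v" by auto
qed

text \<open>Under a binder the substituted terms live in a longer context, which calls for
  weakening, that is, the case \<open>n = 0\<close>. At \<open>n = 0\<close> there are no term
  entries to weaken. The guarded hypothesis expresses this and keeps the induction on
  \<open>n\<close> from being circular.\<close>

lemma ctx_map_extend: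
  assumes "ctx_map \<Sigma> n \<sigma> \<Gamma> \<Gamma>'" "0 < n \<Longrightarrow> sub_check \<Sigma> 0"
    and "x \<notin> fst ` set \<Gamma>" "wt_ty (sg \<Sigma>) (ar \<Gamma>) [] A" "wt_ty (sg \<Sigma>) (ar \<Gamma>') [] A'"
    and "red (sub \<sigma> (emb_ty A)) (emb_ty A')"
  shows "ctx_map \<Sigma> n (\<sigma>(Nm x := Vr (Nm z))) ((x, A) # \<Gamma>) ((z, A') # \<Gamma>')"
proof -
  have wt: "wt_ctx \<Sigma> \<Gamma>" "wt_ctx \<Sigma> \<Gamma>'" "wt_ctx \<Sigma> ((x, A) # \<Gamma>)" "wt_ctx \<Sigma> ((z, A') # \<Gamma>')"
    using assms wt_ctx_Cons by (auto simp: ctx_map_def)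
  have "\<exists>B'. red (sub (\<sigma>(Nm x := Vr (Nm z))) (emb_ty B)) (emb_ty B') \<and>
      ((\<exists>w. (\<sigma>(Nm x := Vr (Nm z))) (Nm y) = Vr (Nm w) \<and> (w, B') \<in> set ((z, A') # \<Gamma>')) \<or>
       (\<exists>M. (\<sigma>(Nm x := Vr (Nm z))) (Nm y) = emb_tm M \<and> check \<Sigma> ((z, A') # \<Gamma>') M B'
         \<and> wt_ty (sg \<Sigma>) (ar ((z, A') # \<Gamma>')) [] B' \<and> size (erase B) < n))"
    if y: "(y, B) \<in> set \<Gamma>" for y B
  proof -
    have "y \<noteq> x" using assms(3) y by force
    have "wt_ty (sg \<Sigma>) (ar \<Gamma>) [] B" using wt(1) y by (auto simp: wt_ctx_def)
    then have eq: "sub (\<sigma>(Nm x := Vr (Nm z))) (emb_ty B) = sub \<sigma> (emb_ty B)"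
      using assms(3) by (rule wt_fresh_ty)
    from assms(1) y obtain B' where B': "red (sub \<sigma> (emb_ty B)) (emb_ty B')" and
      "(\<exists>w. \<sigma> (Nm y) = Vr (Nm w) \<and> (w, B') \<in> set \<Gamma>') \<or>
       (\<exists>M. \<sigma> (Nm y) = emb_tm M \<and> check \<Sigma> \<Gamma>' M B' \<and> wt_ty (sg \<Sigma>) (ar \<Gamma>') [] B' \<and> size (erase B) < n)"
      unfolding ctx_map_def by blast
    then show ?thesis
    proof (elim disjE exE conjE)
      fix M assume M: "\<sigma> (Nm y) = emb_tm M" "check \<Sigma> \<Gamma>' M B'" "wt_ty (sg \<Sigma>) (ar \<Gamma>') [] B'" "size (erase B) < n"
      then have "check \<Sigma> ((z, A') # \<Gamma>') M B'"
        using weaken_check[OF assms(2) wt(2,4)] by auto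
      moreover have "wt_ty (sg \<Sigma>) (ar ((z, A') # \<Gamma>')) [] B'"
        using M(3) by (rule wt_mono_ty) auto
      ultimately show ?thesis using M B' eq \<open>y \<noteq> x\<close> by auto
    qed (use B' eq \<open>y \<noteq> x\<close> in auto)
  qed
  moreover have "red (sub (\<sigma>(Nm x := Vr (Nm z))) (emb_ty A)) (emb_ty A')"
    using assms(6) wt_fresh_ty[OF assms(4,3)] by simp
  moreover have "\<forall>i. (\<sigma>(Nm x := Vr (Nm z))) (Ix i) = Vr (Ix i)" using assms(1) by (simp add: ctx_map_def)
  ultimately show ?thesis using wt unfolding ctx_map_def by simp blast
qed

lemma ctx_map_single:
  assumes "wt_ctx \<Sigma> \<Gamma>" "x \<notin> fst ` set \<Gamma>" "check \<Sigma> \<Gamma> M A" "wt_ty (sg \<Sigma>) (ar \<Gamma>) [] A" "size (erase A) < n"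
  shows "ctx_map \<Sigma> n (Vr(Nm x := emb_tm M)) ((x, A) # \<Gamma>) \<Gamma>"
proof -
  have *: "sub (Vr(Nm x := emb_tm M)) (emb_ty B) = emb_ty B" if "wt_ty (sg \<Sigma>) (ar \<Gamma>) [] B" for B
    using wt_fresh_ty[OF that assms(2)] by simp
  have "\<exists>B'. red (sub (Vr(Nm x := emb_tm M)) (emb_ty B)) (emb_ty B') \<and>
      (\<exists>w. (Vr(Nm x := emb_tm M)) (Nm y) = Vr (Nm w) \<and> (w, B') \<in> set \<Gamma>)"
    if "(y, B) \<in> set \<Gamma>" for y B
  proof -
    have "y \<noteq> x" using assms(2) that by force
    moreover have "wt_ty (sg \<Sigma>) (ar \<Gamma>) [] B" using assms(1) that by (auto simp: wt_ctx_def)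
    ultimately show ?thesis using that * by (intro exI[of _ B]) simp
  qed
  moreover have "\<exists>A'. red (sub (Vr(Nm x := emb_tm M)) (emb_ty A)) (emb_ty A') \<and>
      (\<exists>N. (Vr(Nm x := emb_tm M)) (Nm x) = emb_tm N \<and> check \<Sigma> \<Gamma> N A' \<and> wt_ty (sg \<Sigma>) (ar \<Gamma>) [] A'
      \<and> size (erase A) < n)"
    using *[OF assms(4)] assms(3-5) by (intro exI[of _ A]) simp
  ultimately show ?thesis
    using assms(1) wt_ctx_Cons[OF assms(1,4)] unfolding ctx_map_def by simp blast
qed

text \<open>Composition of substitutions, up to normal forms. The endpoint \<open>n\<close> is known
  for the route that applies \<sigma> to the parts and then instantiates; \<open>red_nf\<close>
  carries it over to the route that instantiates first.\<close>

lemma red_sub_inst: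
  assumes "red (inst t u) w" "red (sub (up \<sigma>) t) t'" "red (sub \<sigma> u) u'" "red (inst t' u') n" "nf n"
  shows "red (sub \<sigma> w) n"
proof -
  have "red (sub \<sigma> (inst t u)) n"
    unfolding sub_inst using red_inst[OF assms(2,3)] assms(4) by (rule rtranclp_trans)
  then show ?thesis using red_nf[OF _ assms(5)] red_sub[OF assms(1)] by blast
qed

lemma ex_fresh_binder:
  assumes "finite X"
  shows "\<exists>z. z \<notin> X \<and> (\<forall>v \<in> fv t. Nm z \<notin> fv (\<sigma> v))"
  using ex_fresh_var[OF assms, of "\<Union>v\<in>fv t. fv (\<sigma> v)"] by (auto simp: finite_fv)

lemma sub_closed_ty: "wt_ty S {} [] A \<Longrightarrow> sub \<sigma> (emb_ty A) = emb_ty A"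
  using wt_fv_ty by (intro sub_id_fv) fastforce

lemma sub_closed_kd: "wt_kd S {} [] K \<Longrightarrow> sub \<sigma> (emb_kd K) = emb_kd K"
  using wt_fv_kd by (intro sub_id_fv) fastforce

text \<open>One round of the induction on \<open>n\<close>. An atomic term may become a canonical
  one, but only if its head variable is replaced by a term, and then its arity stays below
  \<open>n\<close>. The goal for \<open>kind_h\<close> is \<open>True\<close> because the
  simultaneous induction rule also asks for a goal about kinds.\<close>

lemma sub_step:
  assumes \<Sigma>: "wt_sig \<Sigma>" and smaller: "\<And>m. m < n \<Longrightarrow> sub_check \<Sigma> m"
  shows "kind_h \<Sigma> h \<Gamma> K \<Longrightarrow> True"
    and sub_step_type: "type_h \<Sigma> h \<Gamma> A \<Longrightarrow> ctx_map \<Sigma> n \<sigma> \<Gamma> \<Gamma>' \<Longrightarrow>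
      \<exists>A'. red (sub \<sigma> (emb_ty A)) (emb_ty A') \<and> is_type \<Sigma> \<Gamma>' A'"
    and "synth_aty_h \<Sigma> h \<Gamma> P K \<Longrightarrow> ctx_map \<Sigma> n \<sigma> \<Gamma> \<Gamma>' \<Longrightarrow>
      \<exists>P' K'. red (sub \<sigma> (emb_aty P)) (emb_aty P') \<and> red (sub \<sigma> (emb_kd K)) (emb_kd K') \<and> synth_aty \<Sigma> \<Gamma>' P' K'"
    and "synth_h \<Sigma> h \<Gamma> R A \<Longrightarrow> ctx_map \<Sigma> n \<sigma> \<Gamma> \<Gamma>' \<Longrightarrow>
      \<exists>A'. red (sub \<sigma> (emb_ty A)) (emb_ty A') \<and>
        ((\<exists>R'. red (sub \<sigma> (emb_atm R)) (emb_atm R') \<and> synth \<Sigma> \<Gamma>' R' A') \<or>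
         (\<exists>M'. red (sub \<sigma> (emb_atm R)) (emb_tm M') \<and> check \<Sigma> \<Gamma>' M' A' \<and> wt_ty (sg \<Sigma>) (ar \<Gamma>') [] A'
           \<and> size (erase A) < n))"
    and sub_step_check: "check_h \<Sigma> h \<Gamma> M A \<Longrightarrow> ctx_map \<Sigma> n \<sigma> \<Gamma> \<Gamma>' \<Longrightarrow> wt_ty (sg \<Sigma>) (ar \<Gamma>) [] A \<Longrightarrow>
      red (sub \<sigma> (emb_ty A)) (emb_ty A') \<Longrightarrow> wt_ty (sg \<Sigma>) (ar \<Gamma>') [] A' \<Longrightarrow>
      \<exists>M'. red (sub \<sigma> (emb_tm M)) (emb_tm M') \<and> check \<Sigma> \<Gamma>' M' A'"
proof (induction arbitrary: and \<sigma> \<Gamma>' and \<sigma> \<Gamma>' and \<sigma> \<Gamma>' and \<sigma> \<Gamma>' A'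
    rule: kind_h_type_h_synth_aty_h_synth_h_check_h.inducts)
  case (type_base h \<Gamma> P)
  then obtain P' K' where "red (sub \<sigma> (emb_aty P)) (emb_aty P')" "red (Cst CType) (emb_kd K')"
    "synth_aty \<Sigma> \<Gamma>' P' K'" by fastforce
  moreover from this(2) have "K' = Type" using nf_red[OF _ nf_Cst] by (cases K') auto
  ultimately show ?case unfolding is_type_def synth_aty_def
    by (intro exI[of _ "Base P'"]) (auto intro: kind_h_type_h_synth_aty_h_synth_h_check_h.type_base)
next
  case (type_pi x \<Gamma> h1 A1 h2 A2)
  from type_pi.IH(2)[OF type_pi.prems] obtain A1'
    where A1': "red (sub \<sigma> (emb_ty A1)) (emb_ty A1')" "is_type \<Sigma> \<Gamma>' A1'" by blast
  have ctx: "wt_ctx \<Sigma> \<Gamma>" "wt_ctx \<Sigma> \<Gamma>'" "\<And>i. \<sigma> (Ix i) = Vr (Ix i)"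
    using type_pi.prems by (auto simp: ctx_map_def)
  obtain z where z: "z \<notin> fst ` set \<Gamma>'" "\<forall>v \<in> fv (emb_ty A2). Nm z \<notin> fv (\<sigma> v)"
    using ex_fresh_binder[of "fst ` set \<Gamma>'" "emb_ty A2" \<sigma>] by auto
  have "ctx_map \<Sigma> n (\<sigma>(Nm x := Vr (Nm z))) ((x, A1) # \<Gamma>) ((z, A1') # \<Gamma>')"
    using type_pi.hyps type_pi.IH(1) A1' ctx \<Sigma> type_wt unfolding is_type_def
    by (intro ctx_map_extend[OF type_pi.prems smaller]) auto
  from type_pi.IH(4)[OF this] obtain A2'
    where A2': "red (sub (\<sigma>(Nm x := Vr (Nm z))) (emb_ty A2)) (emb_ty A2')" "is_type \<Sigma> ((z, A1') # \<Gamma>') A2'"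
    by blast
  have "is_type \<Sigma> \<Gamma>' (pi z A1' A2')" using z(1) A1'(2) A2'(2) by (rule is_type_pi)
  moreover have "red (sub \<sigma> (emb_ty (pi x A1 A2))) (emb_ty (pi z A1' A2'))"
    using A1'(1) red_ren[OF A2'(1)] up_absr_fresh[OF ctx(3), of "emb_ty A2" x z] z(2)
    by (simp add: emb_pi red_Ap red_Ab)
  ultimately show ?case by blast
next
  case (synth_tconst a K \<Gamma>)
  then have "sub \<sigma> (emb_kd K) = emb_kd K" using \<Sigma> sub_closed_kd unfolding wt_sig_def by blast
  moreover have "synth_aty \<Sigma> \<Gamma>' (TConst a) K"
    unfolding synth_aty_def using synth_tconst kind_h_type_h_synth_aty_h_synth_h_check_h.synth_tconst by blast
  ultimately show ?case by (intro exI[of _ "TConst a"] exI[of _ K]) simp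
next
  case (synth_tapp h1 \<Gamma> P x A K1 h2 M h3 K)
  have ctx: "wt_ctx \<Sigma> \<Gamma>" "wt_ctx \<Sigma> \<Gamma>'" using synth_tapp.prems by (auto simp: ctx_map_def)
  obtain B where B: "KPiB A B = kpi x A K1" by (simp add: kpi_def)
  from synth_tapp.IH(2)[OF synth_tapp.prems] obtain P' T'
    where P': "red (sub \<sigma> (emb_aty P)) (emb_aty P')"
      and T': "red (sub \<sigma> (emb_kd (KPiB A B))) (emb_kd T')" "synth_aty \<Sigma> \<Gamma>' P' T'"
    unfolding B by blast
  from red_sub_KPiB[OF T'(1)] obtain A' B' where AB: "T' = KPiB A' B'"
    "red (sub \<sigma> (emb_ty A)) (emb_ty A')" "red (sub (up \<sigma>) (emb_kd B)) (emb_kd B')" by blast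
  have "wt_ty (sg \<Sigma>) (ar \<Gamma>) [] A" using synth_aty_wt[OF synth_tapp.IH(1) \<Sigma> ctx(1)] B[symmetric] by simp
  moreover have "wt_ty (sg \<Sigma>) (ar \<Gamma>') [] A'"
    using T'(2) synth_aty_wt[OF _ \<Sigma> ctx(2)] AB(1) unfolding synth_aty_def by fastforce
  ultimately obtain M' where M': "red (sub \<sigma> (emb_tm M)) (emb_tm M')" "check \<Sigma> \<Gamma>' M' A'"
    using synth_tapp.IH(4)[OF synth_tapp.prems _ AB(2)] by blast
  obtain K' where K': "red (inst (emb_kd B') (emb_tm M')) (emb_kd K')" "synth_aty \<Sigma> \<Gamma>' (TApp P' M') K'"
    using synth_tapp_ex[OF \<Sigma> ctx(2) _ M'(2)] T'(2) AB(1) by blast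
  have "red (sub \<sigma> (emb_kd K)) (emb_kd K')"
    using inst_sound_kd[OF synth_tapp.hyps(1) B] AB(3) M'(1) K'(1) nf_emb_kd by (rule red_sub_inst)
  with K'(2) P' M'(1) show ?case by (intro exI[of _ "TApp P' M'"] exI[of _ K']) (simp add: red_Ap)
next
  case (check_atm h \<Gamma> R P)
  from check_atm.IH(2)[OF check_atm.prems(1)] check_atm.prems(3) red_emb_ty_unique
  have "(\<exists>R'. red (sub \<sigma> (emb_atm R)) (emb_atm R') \<and> synth \<Sigma> \<Gamma>' R' A') \<or>
      (\<exists>M'. red (sub \<sigma> (emb_atm R)) (emb_tm M') \<and> check \<Sigma> \<Gamma>' M' A')" by blast
  then show ?case
  proof (elim disjE exE conjE)
    fix R' assume "red (sub \<sigma> (emb_atm R)) (emb_atm R')" "synth \<Sigma> \<Gamma>' R' A'"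
    moreover obtain P' where "A' = Base P'" using red_sub_Base check_atm.prems(3) by blast
    ultimately show ?thesis unfolding synth_def check_def
      by (intro exI[of _ "Atm R'"]) (auto intro: kind_h_type_h_synth_aty_h_synth_h_check_h.check_atm)
  qed auto
next
  case (check_lam x \<Gamma> h A1 M A2)
  have ctx: "wt_ctx \<Sigma> \<Gamma>" "wt_ctx \<Sigma> \<Gamma>'" "\<And>i. \<sigma> (Ix i) = Vr (Ix i)"
    using check_lam.prems by (auto simp: ctx_map_def)
  obtain B where B: "PiB A1 B = pi x A1 A2" by (simp add: pi_def)
  from red_sub_PiB[of \<sigma> A1 B A'] check_lam.prems(3) obtain A1' B' where AB: "A' = PiB A1' B'"
    "red (sub \<sigma> (emb_ty A1)) (emb_ty A1')" "red (sub (up \<sigma>) (emb_ty B)) (emb_ty B')" unfolding B by blast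
  \<comment> \<open>\<open>z\<close> must also avoid \<open>B'\<close>, so that this raw body can be
    written as the abstraction of some \<open>A2'\<close> over \<open>z\<close>.\<close>
  obtain z where z: "z \<notin> fst ` set \<Gamma>' \<union> {z. Nm z \<in> fv (emb_ty B')}" "\<forall>v \<in> fv (emb_tm M). Nm z \<notin> fv (\<sigma> v)"
    using ex_fresh_binder[of "fst ` set \<Gamma>' \<union> {z. Nm z \<in> fv (emb_ty B')}" "emb_tm M" \<sigma>]
      finite_vimageI[OF finite_fv, of Nm "emb_ty B'"] by (auto simp: vimage_def inj_def)
  then obtain A2' where "abs_ty 0 z A2' = B'" using ex_abs_ty by blast
  then have A': "A' = pi z A1' A2'" and B': "emb_ty B' = ren (absr z) (emb_ty A2')"
    using AB(1) by (auto simp: pi_def emb_abs_ty)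
  have wt: "wt_ty (sg \<Sigma>) (ar \<Gamma>) [] A1" "wt_ty (sg \<Sigma>) (ar ((x, A1) # \<Gamma>)) [] A2"
    "wt_ty (sg \<Sigma>) (ar \<Gamma>') [] A1'" "wt_ty (sg \<Sigma>) (ar ((z, A1') # \<Gamma>')) [] A2'"
    using check_lam.prems(2,4) A' by (auto dest: wt_piD)
  have map: "ctx_map \<Sigma> n (\<sigma>(Nm x := Vr (Nm z))) ((x, A1) # \<Gamma>) ((z, A1') # \<Gamma>')"
    using check_lam.hyps wt AB(2)
    by (intro ctx_map_extend[OF check_lam.prems(1) smaller]) auto
  have "emb_ty B = ren (absr x) (emb_ty A2)" using B by (simp add: pi_def emb_abs_ty)
  \<comment> \<open>Instantiating both raw bodies with the variable \<open>z\<close> turns the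
    reduction between them into one between the opened types.\<close>
  then have "red (inst (sub (up \<sigma>) (ren (absr x) (emb_ty A2))) (Vr (Nm z))) (inst (ren (absr z) (emb_ty A2')) (Vr (Nm z)))"
    using AB(3) B' by (simp add: red_inst)
  then have "red (sub (\<sigma>(Nm x := Vr (Nm z))) (emb_ty A2)) (emb_ty A2')"
    by (simp add: inst_up_absr inst_absr)
  from check_lam.IH(2)[OF map wt(2) this wt(4)] obtain M'
    where M': "red (sub (\<sigma>(Nm x := Vr (Nm z))) (emb_tm M)) (emb_tm M')" "check \<Sigma> ((z, A1') # \<Gamma>') M' A2'" by blast
  have "check \<Sigma> \<Gamma>' (lam z M') A'" unfolding A' using z(1) M'(2) by (auto intro: check_lamI)
  moreover have "red (sub \<sigma> (emb_tm (lam x M))) (emb_tm (lam z M'))"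
    using red_ren[OF M'(1)] up_absr_fresh[OF ctx(3), of "emb_tm M" x z] z(2)
    by (simp add: emb_lam red_Ab)
  ultimately show ?case by blast
next
  case (synth_var x A \<Gamma>)
  from synth_var.prems synth_var.hyps obtain A' where A': "red (sub \<sigma> (emb_ty A)) (emb_ty A')" and
    "(\<exists>y. \<sigma> (Nm x) = Vr (Nm y) \<and> (y, A') \<in> set \<Gamma>') \<or>
       (\<exists>M. \<sigma> (Nm x) = emb_tm M \<and> check \<Sigma> \<Gamma>' M A' \<and> wt_ty (sg \<Sigma>) (ar \<Gamma>') [] A' \<and> size (erase A) < n)"
    unfolding ctx_map_def by blast
  then show ?case
  proof (elim disjE exE conjE)
    fix y assume "\<sigma> (Nm x) = Vr (Nm y)" "(y, A') \<in> set \<Gamma>'"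
    moreover from this(2) have "synth \<Sigma> \<Gamma>' (FVar y) A'"
      unfolding synth_def using kind_h_type_h_synth_aty_h_synth_h_check_h.synth_var by blast
    ultimately show ?thesis using A' by (intro exI[of _ A'] conjI disjI1 exI[of _ "FVar y"]) auto
  qed (use A' in auto)
next
  case (synth_const c A \<Gamma>)
  then have "sub \<sigma> (emb_ty A) = emb_ty A" using \<Sigma> sub_closed_ty unfolding wt_sig_def by blast
  moreover have "synth \<Sigma> \<Gamma>' (Const c) A"
    unfolding synth_def using synth_const kind_h_type_h_synth_aty_h_synth_h_check_h.synth_const by blast
  ultimately show ?case by (intro exI[of _ A] conjI disjI1 exI[of _ "Const c"]) auto
next
  case (synth_app h1 \<Gamma> R x A1 A2 h2 M h3 A)
  have ctx: "wt_ctx \<Sigma> \<Gamma>" "wt_ctx \<Sigma> \<Gamma>'" using synth_app.prems by (auto simp: ctx_map_def)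
  obtain B where B: "PiB A1 B = pi x A1 A2" by (simp add: pi_def)
  from synth_app.IH(2)[OF synth_app.prems] obtain T'
    where T': "red (sub \<sigma> (emb_ty (PiB A1 B))) (emb_ty T')" and
      R: "(\<exists>R'. red (sub \<sigma> (emb_atm R)) (emb_atm R') \<and> synth \<Sigma> \<Gamma>' R' T') \<or>
         (\<exists>M'. red (sub \<sigma> (emb_atm R)) (emb_tm M') \<and> check \<Sigma> \<Gamma>' M' T' \<and> wt_ty (sg \<Sigma>) (ar \<Gamma>') [] T'
           \<and> size (erase (PiB A1 B)) < n)"
    unfolding B by blast
  from red_sub_PiB[OF T'(1)] obtain A1' B' where AB: "T' = PiB A1' B'"
    "red (sub \<sigma> (emb_ty A1)) (emb_ty A1')" "red (sub (up \<sigma>) (emb_ty B)) (emb_ty B')" by blast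
  have "wt_ty (sg \<Sigma>) (ar \<Gamma>) [] A1" using synth_wt[OF synth_app.IH(1) \<Sigma> ctx(1)] B[symmetric] by simp
  moreover have wt': "wt_ty (sg \<Sigma>) (ar \<Gamma>') [] T'" using R synth_is_wt[OF _ \<Sigma> ctx(2)] by blast
  ultimately obtain M' where M': "red (sub \<sigma> (emb_tm M)) (emb_tm M')" "check \<Sigma> \<Gamma>' M' A1'"
    using synth_app.IH(4)[OF synth_app.prems _ AB(2)] AB(1) by auto
  have square: "red (sub \<sigma> (emb_ty A)) (emb_ty A')" if "red (inst (emb_ty B') (emb_tm M')) (emb_ty A')" for A'
    using inst_sound_ty[OF synth_app.hyps(1) B] AB(3) M'(1) that nf_emb_ty by (rule red_sub_inst)
  from R show ?case
  proof (elim disjE exE conjE)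
    fix R' assume R': "red (sub \<sigma> (emb_atm R)) (emb_atm R')" "synth \<Sigma> \<Gamma>' R' T'"
    then obtain A' where "red (inst (emb_ty B') (emb_tm M')) (emb_ty A')" "synth \<Sigma> \<Gamma>' (App R' M') A'"
      using synth_app_ex[OF \<Sigma> ctx(2) _ M'(2)] AB(1) by blast
    with R' M'(1) square show ?thesis
      by (intro exI[of _ A'] conjI disjI1 exI[of _ "App R' M'"]) (auto intro: red_Ap)
  next
    fix M1 assume M1: "red (sub \<sigma> (emb_atm R)) (emb_tm M1)" "check \<Sigma> \<Gamma>' M1 T'"
      and size: "size (erase (PiB A1 B)) < n"
    \<comment> \<open>A term checked at a product can only come from \<open>check_lam\<close>, whose
      name \<open>z\<close> is fresh for \<Gamma>' whatever name the application used.\<close>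
    from M1(2) AB(1) obtain h where "check_h \<Sigma> h \<Gamma>' M1 (PiB A1' B')" by (auto simp: check_def)
    then obtain z M0 A2' h' where z: "z \<notin> fst ` set \<Gamma>'" and lam: "M1 = lam z M0" "PiB A1' B' = pi z A1' A2'"
      "check_h \<Sigma> h' ((z, A1') # \<Gamma>') M0 A2'"
      by cases (auto simp: pi_def)
    have wt: "wt_ty (sg \<Sigma>) (ar \<Gamma>') [] A1'" "wt_ty (sg \<Sigma>) (ar ((z, A1') # \<Gamma>')) [] A2'"
      using wt' AB(1) lam(2) by (auto dest: wt_piD)
    have "wt_tm (sg \<Sigma>) (ar \<Gamma>') [] M' (erase A1')" using check_is_wt[OF M'(2) \<Sigma> ctx(2) wt(1)] .
    then obtain A' where A': "red (inst (emb_ty B') (emb_tm M')) (emb_ty A')" "wt_ty (sg \<Sigma>) (ar \<Gamma>') [] A'"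
      using inst_total_ty[OF finite.emptyI finite_ar] wt' AB(1) by blast
    \<comment> \<open>The substituted product has the arity of the original one, so its size is
      below \<open>n\<close> and serves as the smaller bound. It exceeds the size of the arity of
      \<open>A1'\<close>, as substituting \<open>M'\<close> requires.\<close>
    have "erase (PiB A1' B') = erase (PiB A1 B)" using red_erase[OF T'] AB(1) by blast
    then have small: "sub_check \<Sigma> (size (erase (PiB A1' B')))" using smaller size by metis
    have map: "ctx_map \<Sigma> (size (erase (PiB A1' B'))) (Vr(Nm z := emb_tm M')) ((z, A1') # \<Gamma>') \<Gamma>'"
      using ctx(2) z M'(2) wt(1) by (rule ctx_map_single) simp
    have eq: "inst (ren (absr z) t) (emb_tm M') = sub (Vr(Nm z := emb_tm M')) t" for t by (rule inst_absr)
    have "emb_ty B' = ren (absr z) (emb_ty A2')" using lam(2) by (simp add: pi_def emb_abs_ty)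
    with A'(1) eq have "red (sub (Vr(Nm z := emb_tm M')) (emb_ty A2')) (emb_ty A')" by simp
    then obtain M'' where M'': "red (sub (Vr(Nm z := emb_tm M')) (emb_tm M0)) (emb_tm M'')" "check \<Sigma> \<Gamma>' M'' A'"
      using small map lam(3) wt(2) A'(2) unfolding sub_check_def by blast
    have "red (sub \<sigma> (emb_atm (App R M))) (inst (ren (absr z) (emb_tm M0)) (emb_tm M'))"
      using M1(1) M'(1) lam(1) by (auto simp: emb_lam intro: red_beta)
    with M''(1) eq have "red (sub \<sigma> (emb_atm (App R M))) (emb_tm M'')" by simp
    \<comment> \<open>The result has the arity of the codomain, a part of the arity already
      bounded.\<close>
    moreover have "size (erase A) < n" using hsub_erase[OF synth_app.hyps(1)] size B by (auto simp: pi_def)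
    ultimately show ?thesis using square[OF A'(1)] M''(2) A'(2) by blast
  qed
qed auto

lemma sub_check_all: "wt_sig \<Sigma> \<Longrightarrow> sub_check \<Sigma> n"
proof (induction n rule: less_induct)
  case (less n)
  show ?case unfolding sub_check_def using sub_step_check[OF less.prems less.IH] less.prems by blast
qed

lemma sub_type:
  "wt_sig \<Sigma> \<Longrightarrow> is_type \<Sigma> \<Gamma> A \<Longrightarrow> ctx_map \<Sigma> n \<sigma> \<Gamma> \<Gamma>' \<Longrightarrow>
    \<exists>A'. red (sub \<sigma> (emb_ty A)) (emb_ty A') \<and> is_type \<Sigma> \<Gamma>' A'"
  unfolding is_type_def[of \<Sigma> \<Gamma>] using sub_step_type[OF _ sub_check_all] by blast

lemma weaken_type:
  assumes "wt_sig \<Sigma>" "wt_ctx \<Sigma> \<Gamma>" "wt_ctx \<Sigma> \<Gamma>'" "set \<Gamma> \<subseteq> set \<Gamma>'" "is_type \<Sigma> \<Gamma> A"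
  shows "is_type \<Sigma> \<Gamma>' A"
  using sub_type[OF assms(1,5) ctx_map_weaken[OF assms(2-4)]] red_emb_ty_unique[of "emb_ty A" A] by auto

section \<open>Regularity\<close>

lemma sig_mono:
  assumes "set \<Sigma> \<subseteq> set \<Sigma>'"
  shows "kind_h \<Sigma> h \<Gamma> K \<Longrightarrow> kind_h \<Sigma>' h \<Gamma> K"
    and "type_h \<Sigma> h \<Gamma> A \<Longrightarrow> type_h \<Sigma>' h \<Gamma> A"
    and "synth_aty_h \<Sigma> h \<Gamma> P K \<Longrightarrow> synth_aty_h \<Sigma>' h \<Gamma> P K"
    and "synth_h \<Sigma> h \<Gamma> R A \<Longrightarrow> synth_h \<Sigma>' h \<Gamma> R A"
    and "check_h \<Sigma> h \<Gamma> M A \<Longrightarrow> check_h \<Sigma>' h \<Gamma> M A"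
proof (induction rule: kind_h_type_h_synth_aty_h_synth_h_check_h.inducts)
  case (synth_tconst a K \<Gamma>)
  then show ?case using assms by (intro kind_h_type_h_synth_aty_h_synth_h_check_h.synth_tconst) auto
next
  case (synth_var x A \<Gamma>)
  then show ?case by (rule kind_h_type_h_synth_aty_h_synth_h_check_h.synth_var)
next
  case (synth_const c A \<Gamma>)
  then show ?case using assms by (intro kind_h_type_h_synth_aty_h_synth_h_check_h.synth_const) auto
next
  case (kind_type \<Gamma>)
  show ?case by (rule kind_h_type_h_synth_aty_h_synth_h_check_h.kind_type)
qed (auto intro: kind_h_type_h_synth_aty_h_synth_h_check_h.intros)

lemma sg_mono: "set \<Sigma> \<subseteq> set \<Sigma>' \<Longrightarrow> sg \<Sigma> \<subseteq> sg \<Sigma>'"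
  by (auto simp: sg_def)

lemma wt_sig_Cons:
  assumes "wt_sig \<Sigma>" "\<And>c A. d = ODecl c A \<Longrightarrow> wt_ty (sg \<Sigma>) {} [] A" "\<And>a K. d = TDecl a K \<Longrightarrow> wt_kd (sg \<Sigma>) {} [] K"
  shows "wt_sig (d # \<Sigma>)"
proof -
  have S: "sg \<Sigma> \<subseteq> sg (d # \<Sigma>)" by (rule sg_mono) auto
  show ?thesis using assms wt_mono_ty[OF _ S subset_refl] wt_mono_kd[OF _ S subset_refl]
    unfolding wt_sig_def by (metis set_ConsD)
qed

lemma wf_sig_wt: "wf_sig \<Sigma> \<Longrightarrow> wt_sig \<Sigma>"
proof (induction rule: wf_sig.induct)
  case sig_empty
  then show ?case by (simp add: wt_sig_def)
next
  case (sig_obj \<Sigma> c A)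
  then show ?case using type_wt[of \<Sigma> _ "[]" A]
    by (intro wt_sig_Cons) (auto simp: is_type_def wt_ctx_def)
next
  case (sig_ty \<Sigma> a K)
  then show ?case using kind_wt[of \<Sigma> _ "[]" K]
    by (intro wt_sig_Cons) (auto simp: is_kind_def wt_ctx_def)
qed

lemma wf_sig_types: "wf_sig \<Sigma> \<Longrightarrow> ODecl c A \<in> set \<Sigma> \<Longrightarrow> is_type \<Sigma> [] A"
proof (induction rule: wf_sig.induct)
  case (sig_obj \<Sigma> d B)
  then have "is_type \<Sigma> [] A" by auto
  then show ?case using sig_mono(2)[of \<Sigma> "ODecl d B # \<Sigma>"] by (auto simp: is_type_def)
next
  case (sig_ty \<Sigma> a K)
  then have "is_type \<Sigma> [] A" by auto
  then show ?case using sig_mono(2)[of \<Sigma> "TDecl a K # \<Sigma>"] by (auto simp: is_type_def)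
qed simp

lemma is_ctx_wt: "is_ctx \<Sigma> \<Gamma> \<Longrightarrow> wt_sig \<Sigma> \<Longrightarrow> wt_ctx \<Sigma> \<Gamma>"
proof (induction rule: is_ctx.induct)
  case ctx_empty
  then show ?case by (simp add: wt_ctx_def)
next
  case (ctx_ext \<Gamma> A x)
  then show ?case using type_wt by (auto simp: is_type_def intro!: wt_ctx_Cons)
qed

lemma is_ctx_types: "is_ctx \<Sigma> \<Gamma> \<Longrightarrow> wt_sig \<Sigma> \<Longrightarrow> (y, B) \<in> set \<Gamma> \<Longrightarrow> is_type \<Sigma> \<Gamma> B"
proof (induction rule: is_ctx.induct)
  case (ctx_ext \<Gamma> A x)
  then have "is_type \<Sigma> \<Gamma> B" by auto
  moreover have "wt_ctx \<Sigma> \<Gamma>" "wt_ctx \<Sigma> ((x, A) # \<Gamma>)"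
    using ctx_ext is_ctx_wt is_ctx.ctx_ext by blast+
  ultimately show ?case using ctx_ext.prems weaken_type[of \<Sigma> \<Gamma> "(x, A) # \<Gamma>" B] by auto
qed simp

text \<open>Inverting the formation of the product types its body under a fresh name, where the
  substitution theorem applies. Uniqueness of normal forms identifies the outcome with
  \<open>A\<close>, whatever name the application rule used.\<close>

lemma synth_is_type:
  assumes "wf_sig \<Sigma>" "is_ctx \<Sigma> \<Gamma>"
  shows "synth_h \<Sigma> h \<Gamma> R A \<Longrightarrow> is_type \<Sigma> \<Gamma> A"
proof (induction h arbitrary: R A rule: less_induct)
  case (less h)
  note \<Sigma> = wf_sig_wt[OF assms(1)]
  note \<Gamma> = is_ctx_wt[OF assms(2) \<Sigma>]
  from less.prems show ?case
  proof cases
    case (synth_var x)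
    then show ?thesis using is_ctx_types[OF assms(2) \<Sigma>] by blast
  next
    case (synth_const c)
    then have "is_type \<Sigma> [] A" using wf_sig_types[OF assms(1)] by blast
    then show ?thesis using weaken_type[OF \<Sigma> _ \<Gamma>, of "[]"] by (simp add: wt_ctx_def)
  next
    case (synth_app h1 R' x A1 A2 h2 M h3)
    obtain B where B: "PiB A1 B = pi x A1 A2" by (simp add: pi_def)
    have "is_type \<Sigma> \<Gamma> (PiB A1 B)" unfolding B using less.IH[OF _ synth_app(3)] synth_app(1) by simp
    then obtain h' where "type_h \<Sigma> h' \<Gamma> (PiB A1 B)" by (auto simp: is_type_def)
    then obtain z A2' h'' where z: "z \<notin> fst ` set \<Gamma>" "PiB A1 B = pi z A1 A2'" "type_h \<Sigma> h'' ((z, A1) # \<Gamma>) A2'"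
      by cases (auto simp: pi_def)
    have "wt_ty (sg \<Sigma>) (ar \<Gamma>) [] A1"
      using synth_wt[OF synth_app(3) \<Sigma> \<Gamma>] B[symmetric] by simp
    then have "ctx_map \<Sigma> (Suc (size (erase A1))) (Vr(Nm z := emb_tm M)) ((z, A1) # \<Gamma>) \<Gamma>"
      using \<Gamma> z(1) synth_app(4) by (intro ctx_map_single) (auto simp: check_def)
    with sub_type[OF \<Sigma> _ this, of A2'] z(3) obtain A'
      where A': "red (sub (Vr(Nm z := emb_tm M)) (emb_ty A2')) (emb_ty A')" "is_type \<Sigma> \<Gamma> A'"
      by (auto simp: is_type_def)
    have "emb_ty B = ren (absr z) (emb_ty A2')" using z(2) by (simp add: pi_def emb_abs_ty)
    then have "red (sub (Vr(Nm z := emb_tm M)) (emb_ty A2')) (emb_ty A)"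
      using inst_sound_ty[OF synth_app(5) B] by (simp add: inst_absr)
    with A' red_emb_ty_unique show ?thesis by blast
  qed
qed

section \<open>Argument spines\<close>

text \<open>Later entries override earlier ones, so this matches the set \<open>arg_subst\<close>
  when the names are distinct.\<close>

primrec arg_env :: "(var \<times> ty) list \<Rightarrow> tm list \<Rightarrow> nat \<Rightarrow> vr \<Rightarrow> lt" where
  "arg_env bs Ms 0 = Vr"
| "arg_env bs Ms (Suc i) = (arg_env bs Ms i)(Nm (fst (bs ! i)) := emb_tm (Ms ! i))"

lemma arg_subst_Suc: "arg_subst bs Ms (Suc i) = insert (fst (bs ! i), Ms ! i, erase (snd (bs ! i))) (arg_subst bs Ms i)"
  by (auto simp: arg_subst_def less_Suc_eq)

lemma arg_subst_0: "arg_subst bs Ms 0 = {}"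
  by (simp add: arg_subst_def)

lemma sdom_arg_subst: "sdom (arg_subst bs Ms i) = (\<lambda>j. fst (bs ! j)) ` {..<i}"
  by (force simp: sdom_def arg_subst_def)

lemma agrees_arg_env:
  "distinct (map fst bs) \<Longrightarrow> i \<le> length bs \<Longrightarrow> agrees (arg_env bs Ms i) (arg_subst bs Ms i)"
proof (induction i)
  case 0
  then show ?case by (simp add: arg_subst_0 agrees_def sdom_def)
next
  case (Suc i)
  have "fst (bs ! i) \<noteq> fst (bs ! j)" if "j < i" for j
    using nth_eq_iff_index_eq[OF Suc.prems(1), of i j] that Suc.prems(2) by auto
  then have "fst (bs ! i) \<notin> sdom (arg_subst bs Ms i)" by (auto simp: sdom_arg_subst)
  with Suc show ?case by (fastforce simp: agrees_def arg_subst_Suc sdom_def)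
qed

lemma pis_snoc: "pis (bs @ [(y, B)]) A = pis bs (pi y B A)"
  by (induction bs "pi y B A" rule: pis.induct) auto

lemma arg_subst_append: "i \<le> length bs \<Longrightarrow> length Ms = length bs \<Longrightarrow> arg_subst (bs @ bs') (Ms @ Ms') i = arg_subst bs Ms i"
  by (induction i) (auto simp: arg_subst_0 arg_subst_Suc nth_append)

lemma arg_env_append: "i \<le> length bs \<Longrightarrow> length Ms = length bs \<Longrightarrow> arg_env (bs @ bs') (Ms @ Ms') i = arg_env bs Ms i"
  by (induction i) (auto simp: nth_append)

lemma apps_snoc: "apps H (Ms @ [M]) = App (apps H Ms) M"
  by (simp add: apps_def)

text \<open>Induction along the spine with the remaining telescope as invariant: its normal form
  under the arguments so far is the type synthesized. Binder names may occur in \<Gamma>, since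
  \<open>inst_up_absr\<close> has no freshness condition.\<close>

lemma synth_apps:
  assumes "wt_sig \<Sigma>" "wt_ctx \<Sigma> \<Gamma>" "synth \<Sigma> \<Gamma> H (pis bs A)" "distinct (map fst bs)" "length Ms = length bs"
    and args: "\<forall>i < length bs. hsub_ty (arg_subst bs Ms i) (snd (bs ! i)) (As' ! i) \<and> check \<Sigma> \<Gamma> (Ms ! i) (As' ! i)"
  shows "i \<le> length bs \<Longrightarrow> \<exists>T. red (sub (arg_env bs Ms i) (emb_ty (pis (drop i bs) A))) (emb_ty T)
    \<and> synth \<Sigma> \<Gamma> (apps H (take i Ms)) T"
proof (induction i)
  case 0
  then show ?case using assms(3) by (auto simp: apps_def)
next
  case (Suc i)
  then obtain T where T: "red (sub (arg_env bs Ms i) (emb_ty (pis (drop i bs) A))) (emb_ty T)"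
    "synth \<Sigma> \<Gamma> (apps H (take i Ms)) T" by auto
  obtain y Ai where y: "bs ! i = (y, Ai)" by force
  let ?rest = "pis (drop (Suc i) bs) A"
  have "pis (drop i bs) A = PiB Ai (abs_ty 0 y ?rest)"
    using Suc.prems y Cons_nth_drop_Suc[of i bs] by (metis Suc_le_lessD pi_def pis.simps(2))
  with red_sub_PiB[of "arg_env bs Ms i" Ai "abs_ty 0 y ?rest" T] T(1) obtain A' B' where AB: "T = PiB A' B'"
    "red (sub (arg_env bs Ms i) (emb_ty Ai)) (emb_ty A')"
    "red (sub (up (arg_env bs Ms i)) (ren (absr y) (emb_ty ?rest))) (emb_ty B')"
    by (auto simp: emb_abs_ty)
  have "hsub_ty (arg_subst bs Ms i) Ai (As' ! i)" and M: "check \<Sigma> \<Gamma> (Ms ! i) (As' ! i)"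
    using args[rule_format, of i] Suc.prems y by auto
  then have "red (sub (arg_env bs Ms i) (emb_ty Ai)) (emb_ty (As' ! i))"
    using hsub_sound_ty agrees_arg_env[OF assms(4), of i Ms] Suc.prems unfolding hsub_ty_def by auto
  \<comment> \<open>The domain the rule expects and the given type are normal forms of one instance,
    so the given check is the premise needed.\<close>
  with AB(2) have "A' = As' ! i" by (rule red_emb_ty_unique)
  with AB(1) M T(2) synth_app_ex[OF assms(1,2)] obtain T'
    where T': "red (inst (emb_ty B') (emb_tm (Ms ! i))) (emb_ty T')" "synth \<Sigma> \<Gamma> (App (apps H (take i Ms)) (Ms ! i)) T'"
    by blast
  have "red (sub (arg_env bs Ms (Suc i)) (emb_ty ?rest)) (inst (emb_ty B') (emb_tm (Ms ! i)))"
    using red_inst[OF AB(3) rtranclp.rtrancl_refl[of par "emb_tm (Ms ! i)"]] y by (simp add: inst_up_absr)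
  with T'(1) have "red (sub (arg_env bs Ms (Suc i)) (emb_ty ?rest)) (emb_ty T')" by simp
  moreover have "apps H (take (Suc i) Ms) = App (apps H (take i Ms)) (Ms ! i)"
    using Suc.prems assms(5) by (simp add: take_Suc_conv_app_nth apps_snoc)
  ultimately show ?case using T'(2) by metis
qed

text \<open>The names of \<Theta> must be left fixed, hence the disjointness. Any number above the
  finitely many arity sizes will do for \<open>n\<close>.\<close>

lemma wt_sub_args:
  assumes "length Ms = length bs" "fst ` set bs \<inter> fst ` \<Theta> = {}" "finite \<Theta>"
    "\<forall>i < length bs. wt_tm S \<Theta> [] (Ms ! i) (erase (snd (bs ! i)))"
  shows "\<exists>n. wt_sub S n (arg_subst bs Ms (length bs)) (\<Theta> \<union> ar bs) \<Theta>"
proof -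
  have "finite (size ` snd ` ar bs)" by simp
  then obtain n where n: "\<And>x \<beta>. (x, \<beta>) \<in> ar bs \<Longrightarrow> size \<beta> < n"
    by (force simp: finite_nat_set_iff_bounded)
  have "\<exists>M. (x, M, \<beta>) \<in> arg_subst bs Ms (length bs) \<and> wt_tm S \<Theta> [] M \<beta> \<and> size \<beta> < n" if "(x, \<beta>) \<in> ar bs" for x \<beta>
  proof -
    from that obtain j where "j < length bs" "x = fst (bs ! j)" "\<beta> = erase (snd (bs ! j))"
      by (force simp: ar_def in_set_conv_nth)
    with assms(4) n[OF that] show ?thesis by (auto simp: arg_subst_def)
  qed
  moreover have "x \<notin> sdom (arg_subst bs Ms (length bs))" if "(x, \<beta>) \<in> \<Theta>" for x \<beta>
    using assms(2) that by (force simp: sdom_arg_subst)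
  moreover have "finite (arg_subst bs Ms (length bs))" by (simp add: arg_subst_def)
  ultimately show ?thesis using assms(3) unfolding wt_sub_def by (intro exI[of _ n]) auto
qed

text \<open>The last three conjuncts strengthen the induction: fresh names and arity typing make the
  simultaneous substitution total on the next domain and codomain when an argument is
  appended.\<close>

lemma synth_spine:
  assumes "wt_sig \<Sigma>" "wt_ctx \<Sigma> \<Gamma>"
  shows "synth_h \<Sigma> h \<Gamma> R A' \<Longrightarrow> \<exists>bs A Ms As'. spine_form \<Sigma> \<Gamma> R bs A Ms \<and> length As' = length bs \<and>
    (\<forall>i < length bs. hsub_ty (arg_subst bs Ms i) (snd (bs ! i)) (As' ! i) \<and> (\<exists>h' < h. check_h \<Sigma> h' \<Gamma> (Ms ! i) (As' ! i))) \<and>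
    hsub_ty (arg_subst bs Ms (length bs)) A A' \<and>
    fst ` set bs \<inter> fst ` set \<Gamma> = {} \<and> wt_ty (sg \<Sigma>) (ar \<Gamma> \<union> ar bs) [] A \<and>
    (\<forall>i < length bs. wt_tm (sg \<Sigma>) (ar \<Gamma>) [] (Ms ! i) (erase (snd (bs ! i))))"
proof (induction h arbitrary: R A' rule: less_induct)
  case (less h)
  \<comment> \<open>For an empty spine the final substitution is empty. Totality (with bound 0, as
    nothing is substituted) gives some result, and this is a reduct of the normal
    \<open>A'\<close>.\<close>
  have empty: "hsub_ty {} A' A'"
  proof -
    have wt: "wt_ty (sg \<Sigma>) (ar \<Gamma>) [] A'" using synth_wt[OF less.prems assms] by blast
    obtain A'' where "hsub_ty {} A' A''"
      using hsub_total_ty[OF _ wt, of 0 "{}" "ar \<Gamma>"] by (auto simp: wt_sub_def sdom_def)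
    moreover from this have "red (sub Vr (emb_ty A')) (emb_ty A'')"
      unfolding hsub_ty_def using hsub_sound_ty[of _ "{}" A' A'' Vr] by (auto simp: agrees_def sdom_def)
    ultimately show ?thesis using red_emb_ty_unique[of "emb_ty A'" A' A''] by simp
  qed
  from less.prems show ?case
  proof cases
    case (synth_var x)
    then show ?thesis using empty synth_wt[OF less.prems assms]
      by (intro exI[of _ "[]"] exI[of _ A']) (auto simp: spine_form_def apps_def arg_subst_0)
  next
    case (synth_const c)
    then show ?thesis using empty synth_wt[OF less.prems assms]
      by (intro exI[of _ "[]"] exI[of _ A']) (auto simp: spine_form_def apps_def arg_subst_0)
  next
    case (synth_app h1 Q x A1 A2 h2 M h3)
    have "h1 < h" using synth_app(1) by simp
    from less.IH[OF this synth_app(3)] obtain bs A Ms As' where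
      spine: "spine_form \<Sigma> \<Gamma> Q bs A Ms" and len: "length As' = length bs" and
      args: "\<forall>i < length bs. hsub_ty (arg_subst bs Ms i) (snd (bs ! i)) (As' ! i) \<and> (\<exists>h' < h1. check_h \<Sigma> h' \<Gamma> (Ms ! i) (As' ! i))" and
      A: "hsub_ty (arg_subst bs Ms (length bs)) A (pi x A1 A2)" and
      disj: "fst ` set bs \<inter> fst ` set \<Gamma> = {}" and wtA: "wt_ty (sg \<Sigma>) (ar \<Gamma> \<union> ar bs) [] A" and
      wtM: "\<forall>i < length bs. wt_tm (sg \<Sigma>) (ar \<Gamma>) [] (Ms ! i) (erase (snd (bs ! i)))"
      by blast
    let ?\<theta> = "arg_subst bs Ms (length bs)" and ?\<sigma> = "arg_env bs Ms (length bs)"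
    have lenM: "length Ms = length bs" and dist: "distinct (map fst bs)" using spine by (auto simp: spine_form_def)
    obtain B where B: "PiB A1 B = pi x A1 A2" by (simp add: pi_def)
    \<comment> \<open>Substitution keeps arities, so a product as result forces \<open>A\<close>
      itself to be a product.\<close>
    have "erase A = erase (pi x A1 A2)" using A hsub_erase unfolding hsub_ty_def by metis
    then obtain C D0 where "A = PiB C D0" by (cases A) (auto simp: pi_def)
    \<comment> \<open>The declared binder is reopened under a name outside \<Gamma> and the earlier
      names, as distinctness and totality require.\<close>
    then obtain y D where y: "y \<notin> fst ` set bs \<union> fst ` set \<Gamma>" and AC: "A = pi y C D"
      using fresh_pi[of "fst ` set bs \<union> fst ` set \<Gamma>" C D0] by auto
    let ?bs = "bs @ [(y, C)]" and ?Ms = "Ms @ [M]" and ?As = "As' @ [A1]"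
    have wtC: "wt_ty (sg \<Sigma>) (ar \<Gamma> \<union> ar bs) [] C" and wtD: "wt_ty (sg \<Sigma>) (ar \<Gamma> \<union> ar ?bs) [] D"
      using wtA AC by (auto dest: wt_piD)
    have "agrees ?\<sigma> ?\<theta>" using agrees_arg_env[OF dist] by blast
    then have "red (sub ?\<sigma> (emb_ty (PiB C (abs_ty 0 y D)))) (emb_ty (PiB A1 B))"
      using A AC hsub_sound_ty unfolding hsub_ty_def B pi_def by blast
    from red_sub_PiB[OF this] have redC: "red (sub ?\<sigma> (emb_ty C)) (emb_ty A1)"
      and redD: "red (sub (up ?\<sigma>) (ren (absr y) (emb_ty D))) (emb_ty B)" by (auto simp: emb_abs_ty)
    obtain n where "wt_sub (sg \<Sigma>) n ?\<theta> (ar \<Gamma> \<union> ar bs) (ar \<Gamma>)"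
      using wt_sub_args[OF lenM _ _ wtM] disj by auto
    \<comment> \<open>A substitution derivation is required, but only a reduction to
      \<open>A1\<close> is known: totality produces a derivation, and uniqueness makes its result
      \<open>A1\<close>.\<close>
    then obtain C' where C': "hsub_ty ?\<theta> C C'" using hsub_total_ty wtC by blast
    then have "red (sub ?\<sigma> (emb_ty C)) (emb_ty C')"
      using \<open>agrees ?\<sigma> ?\<theta>\<close> hsub_sound_ty unfolding hsub_ty_def by blast
    with redC have "C' = A1" by (metis red_emb_ty_unique)
    with C' have hC: "hsub_ty ?\<theta> C A1" by simp
    then have "erase A1 = erase C" using hsub_erase unfolding hsub_ty_def by blast
    moreover have "wt_ty (sg \<Sigma>) (ar \<Gamma>) [] A1" using synth_wt[OF synth_app(3) assms] B[symmetric] by simp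
    ultimately have "wt_tm (sg \<Sigma>) (ar \<Gamma>) [] M (erase C)" using check_wt[OF synth_app(4) assms] by simp
    then have wtM': "\<forall>i < length ?bs. wt_tm (sg \<Sigma>) (ar \<Gamma>) [] (?Ms ! i) (erase (snd (?bs ! i)))"
      using wtM lenM by (auto simp: nth_append)
    have dist': "distinct (map fst ?bs)" and disj': "fst ` set ?bs \<inter> fst ` set \<Gamma> = {}"
      using dist disj y by auto
    let ?\<theta>' = "arg_subst ?bs ?Ms (length ?bs)" and ?\<sigma>' = "arg_env ?bs ?Ms (length ?bs)"
    obtain n' where "wt_sub (sg \<Sigma>) n' ?\<theta>' (ar \<Gamma> \<union> ar ?bs) (ar \<Gamma>)"
      using wt_sub_args[OF _ _ finite_ar wtM'] lenM disj' unfolding fst_ar by auto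
    then obtain D' where D': "hsub_ty ?\<theta>' D D'" using hsub_total_ty wtD by blast
    then have "red (sub ?\<sigma>' (emb_ty D)) (emb_ty D')"
      using agrees_arg_env[OF dist' order_refl] hsub_sound_ty unfolding hsub_ty_def by blast
    \<comment> \<open>The one-variable instance taken by the rule continues the simultaneous
      substitution of the earlier arguments.\<close>
    moreover have "red (sub ?\<sigma>' (emb_ty D)) (emb_ty A')"
    proof -
      have "?\<sigma>' = ?\<sigma>(Nm y := emb_tm M)" using lenM by (simp add: arg_env_append nth_append)
      then have "red (sub ?\<sigma>' (emb_ty D)) (inst (emb_ty B) (emb_tm M))"
        using red_inst[OF redD rtranclp.rtrancl_refl[of par "emb_tm M"]] by (simp add: inst_up_absr)
      with inst_sound_ty[OF synth_app(5) B] show ?thesis by simp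
    qed
    ultimately have "D' = A'" by (metis red_emb_ty_unique)
    with D' have hD: "hsub_ty ?\<theta>' D A'" by simp
    have spine': "spine_form \<Sigma> \<Gamma> R ?bs D ?Ms"
      using spine dist' synth_app(2) unfolding spine_form_def by (auto simp: pis_snoc AC apps_snoc)
    have args': "\<forall>i < length ?bs. hsub_ty (arg_subst ?bs ?Ms i) (snd (?bs ! i)) (?As ! i) \<and>
        (\<exists>h' < h. check_h \<Sigma> h' \<Gamma> (?Ms ! i) (?As ! i))"
    proof (intro allI impI)
      fix i assume i: "i < length ?bs"
      show "hsub_ty (arg_subst ?bs ?Ms i) (snd (?bs ! i)) (?As ! i) \<and> (\<exists>h' < h. check_h \<Sigma> h' \<Gamma> (?Ms ! i) (?As ! i))"
      proof (cases "i < length bs")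
        case True
        moreover from this args obtain h' where "h' < h1" "check_h \<Sigma> h' \<Gamma> (Ms ! i) (As' ! i)" by blast
        moreover from this(1) have "h' < h" using synth_app(1) by simp
        ultimately show ?thesis using args lenM len by (auto simp: arg_subst_append nth_append)
      next
        case False
        with i have "i = length bs" by simp
        moreover have "h2 < h" using synth_app(1) by simp
        ultimately show ?thesis using hC lenM len synth_app(4) by (auto simp: arg_subst_append nth_append)
      qed
    qed
    show ?thesis
      by (rule exI[of _ ?bs], rule exI[of _ D], rule exI[of _ ?Ms], rule exI[of _ ?As])
        (intro conjI spine' args' hD disj' wtD wtM', simp add: len)
  qed
qed

theorem theorem2p20:
  fixes \<Sigma> :: sig and \<Gamma> :: ctx and R :: atm and A' :: ty
  assumes "wf_sig \<Sigma>" and "is_ctx \<Sigma> \<Gamma>"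
  shows
    "(\<forall>bs A Ms As'.
        spine_form \<Sigma> \<Gamma> R bs A Ms \<and>
        length As' = length bs \<and>
        (\<forall>i < length bs. hsub_ty (arg_subst bs Ms i) (snd (bs ! i)) (As' ! i) \<and>
                         check \<Sigma> \<Gamma> (Ms ! i) (As' ! i)) \<and>
        hsub_ty (arg_subst bs Ms (length bs)) A A' \<and> is_type \<Sigma> \<Gamma> A'
        \<longrightarrow> synth \<Sigma> \<Gamma> R A')
     \<and>
     (\<forall>h. synth_h \<Sigma> h \<Gamma> R A' \<longrightarrow>
        (\<exists>bs A Ms As'.
          spine_form \<Sigma> \<Gamma> R bs A Ms \<and>
          length As' = length bs \<and>
          (\<forall>i < length bs. hsub_ty (arg_subst bs Ms i) (snd (bs ! i)) (As' ! i) \<and>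
                           (\<exists>h' < h. check_h \<Sigma> h' \<Gamma> (Ms ! i) (As' ! i))) \<and>
          hsub_ty (arg_subst bs Ms (length bs)) A A' \<and> is_type \<Sigma> \<Gamma> A'))"
proof -
  note \<Sigma> = wf_sig_wt[OF assms(1)]
  note \<Gamma> = is_ctx_wt[OF assms(2) \<Sigma>]
  show ?thesis
  proof (intro conjI allI impI; (elim conjE)?)
    fix bs A Ms As'
    assume spine: "spine_form \<Sigma> \<Gamma> R bs A Ms"
      and args: "\<forall>i < length bs. hsub_ty (arg_subst bs Ms i) (snd (bs ! i)) (As' ! i) \<and> check \<Sigma> \<Gamma> (Ms ! i) (As' ! i)"
      and A: "hsub_ty (arg_subst bs Ms (length bs)) A A'"
    from spine obtain H where H: "synth \<Sigma> \<Gamma> H (pis bs A)" "R = apps H Ms"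
      unfolding spine_form_def synth_def using synth_var synth_const by blast
    have len: "length Ms = length bs" and dist: "distinct (map fst bs)" using spine by (auto simp: spine_form_def)
    from synth_apps[OF \<Sigma> \<Gamma> H(1) dist len args order_refl] obtain T
      where T: "red (sub (arg_env bs Ms (length bs)) (emb_ty A)) (emb_ty T)" "synth \<Sigma> \<Gamma> R T"
      using H(2) len by auto
    have "red (sub (arg_env bs Ms (length bs)) (emb_ty A)) (emb_ty A')"
      using A hsub_sound_ty agrees_arg_env[OF dist order_refl] unfolding hsub_ty_def by blast
    with T(1) have "T = A'" by (rule red_emb_ty_unique)
    with T(2) show "synth \<Sigma> \<Gamma> R A'" by simp
  next
    fix h assume h: "synth_h \<Sigma> h \<Gamma> R A'"
    show "\<exists>bs A Ms As'.
          spine_form \<Sigma> \<Gamma> R bs A Ms \<and>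
          length As' = length bs \<and>
          (\<forall>i < length bs. hsub_ty (arg_subst bs Ms i) (snd (bs ! i)) (As' ! i) \<and>
                           (\<exists>h' < h. check_h \<Sigma> h' \<Gamma> (Ms ! i) (As' ! i))) \<and>
          hsub_ty (arg_subst bs Ms (length bs)) A A' \<and> is_type \<Sigma> \<Gamma> A'"
      using synth_spine[OF \<Sigma> \<Gamma> h] synth_is_type[OF assms h] by blast
  qed
qed

end
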